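(* Let $Y=X\beta+\epsilon$ with $\beta\in\mathbb{R}^p$ $s$-sparse, $\epsilon\sim N(0,\sigma^2I_n)$ and $\|X_j\|_2=\sqrt n$ for all $j\in[p]$. Let $s_0$ be the essential sparsity of $\beta$ and let $T_0$ be the set of positions of the $s_0$ largest coordinates of $\beta$ in absolute value. Suppose $\mathrm{RE}(s_0,4,X)$ holds and $\Lambda_{\max}(2s)<\infty$. Let $a\ge0$, $d_0\ge2\sqrt{1+a}$, and let $\beta_{\mathrm{init}}$ be an optimal solution of the Lasso $$\min_{b\in\mathbb{R}^p}\ \frac1{2n}\|Y-Xb\|_2^2+\lambda_n\|b\|_1,\qquad \lambda_n=d_0\lambda\sigma\ \ (\ge2\lambda_{\sigma,a,p}).$$ Let $h=\beta_{\mathrm{init}}-\beta^{\natural}(T_0)$. Then on the event $\mathcal{T}_a$, $$\|\beta_{\mathrm{init}}-\beta\|_2\le\lambda\sigma\sqrt{s_0}\,\big(\sqrt{D_0^2+D_1^2}+1\big),$$ $$\|h_{T_0}\|_1+\|h_{T_0^c}\|_1=\|\beta_{T_0}-\beta_{\mathrm{init},T_0}\|_1+\|\beta_{\mathrm{init},T_0^c}\|_1\le D_2\lambda\sigma s_0,$$ $$\|X\beta_{\mathrm{init}}-X\beta\|_2/\sqrt n\le D_3\lambda\sigma\sqrt{s_0}.$$ Moreover (on $\mathcal{T}_a$), for any subset $I_0\subset S$ such that $\mathrm{RE}(|I_0|,4,X)$ holds with $K(|I_0|,4)$, $$\frac{\|X\beta_{\mathrm{init}}-X\beta\|_2}{\sqrt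 n}\le\frac{\|X\beta-X_{I_0}\beta_{I_0}\|_2}{\sqrt n}+\frac32K(|I_0|,4)\,\lambda_n\sqrt{|I_0|}.$$
   Context: Setting: $n,p$ are positive integers with $p\ge n$, $p\ge2$; $[p]=\{1,\dots,p\}$; $X\in\mathbb{R}^{n\times p}$ is a fixed design matrix with columns $X_j$; $\sigma>0$; $S=\mathrm{supp}(\beta)$ and $s=|S|$; $\lambda=\sqrt{2\log p/n}$. For $T\subseteq[p]$, $X_T$ is the submatrix of columns indexed by $T$, $v_T$ is the restriction of a vector $v$ to $T$, and $\beta^{\natural}(T)\in\mathbb{R}^p$ equals $\beta$ on $T$ and $0$ on $T^c$. A vector is $m$-sparse if it has at most $m$ nonzero entries. $x\vee y=\max(x,y)$, $x\wedge y=\min(x,y)$. Essential sparsity: $s_0$ is the smallest integer such that $\sum_{i=1}^p\min(\beta_i^2,\lambda^2\sigma^2)\le s_0\lambda^2\sigma^2$. Sparse eigenvalues: $\Lambda_{\max}(m)=\max\|Xv\|_2^2/(n\|v\|_2^2)$ and $\Lambda_{\min}(m)=\min\|Xv\|_2^2/(n\|v\|_2^2)$, both over nonzero $m$-sparse $v\in\mathbb{R}^p$; $\Lambda_{\max}(0)=0$. Restricted orthogonality: $\theta_{m,m'}$ is the smallest number such that $|\langle X_Tv,X_{T'}v'\rangle|/n\le\theta_{m,m'}\|v\|_2\|v'\|_2$ for all disjoint $T,T'\subseteq[p]$ with $|T|\le m$, $|T'|\le m'$ and all $v\in\mathbb{R}^{|T|},v'\in\mathbb{R}^{|T'|}$.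 Restricted eigenvalue: for $m\in[p]$, $k_0>0$, $\mathrm{RE}(m,k_0,X)$ holds with $K(m,k_0)$ if $$\frac1{K(m,k_0)}:=\min_{J\subseteq[p],|J|\le m}\ \min_{v\ne0,\ \|v_{J^c}\|_1\le k_0\|v_J\|_1}\frac{\|Xv\|_2}{\sqrt n\,\|v_J\|_2}>0.$$ Noise event: for $a\ge0$, $\lambda_{\sigma,a,p}=\sigma\sqrt{1+a}\sqrt{2\log p/n}$ and $\mathcal{T}_a=\{\epsilon:\|X^T\epsilon/n\|_\infty\le\lambda_{\sigma,a,p}\}$. Constants: $$\ell(s_0)=\frac{\theta_{s_0,2s_0}}{\sqrt{\Lambda_{\min}(2s_0)}}\wedge\sqrt{\Lambda_{\max}(s_0)},\qquad D=\sqrt{\frac{\Lambda_{\max}(s-s_0)}{\Lambda_{\min}(2s_0)}}\Big(1+\frac{3\ell(s_0)\sqrt{\Lambda_{\max}(s-s_0)}}{d_0}\Big),$$ $$D_0=D\vee\sqrt2\big(d_0K^2(s_0,4)+K(s_0,3)\sqrt{\Lambda_{\max}(s-s_0)}+2d_0K^2(s_0,3)\big),$$ $$D_1=d_0\Big[\Big(\frac{\Lambda_{\max}(s-s_0)}{d_0^2}+\frac94K^2(s_0,3)\Big)\vee4K^2(s_0,4)\vee\frac{3\Lambda_{\max}(s-s_0)}{d_0^2}\Big],$$ $$D_2=d_0\Big[\Big(\frac{\Lambda_{\max}(s-s_0)}{d_0^2}+4K^2(s_0,3)\Big)\vee5K^2(s_0,4)\vee\frac{4\Lambda_{\max}(s-s_0)}{d_0^2}\Big],$$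 $$D_3=\sqrt{\Lambda_{\max}(s-s_0)}+d_0K(s_0,4)/2+d_0K(s_0,3).$$ (Under $\mathrm{RE}(s_0,4,X)$ one has $\Lambda_{\min}(2s_0)>0$, so these are well defined.) *)

theory Defs
  imports "HOL-Probability.Probability"
begin

text \<open>
  The dimensions \<open>n\<close> and \<open>p\<close> are \<open>CARD('n)\<close> and \<open>CARD('p)\<close>; a subvector \<open>v\<^sub>T\<close> is represented
  by the entries of \<open>v\<close> at the indices in \<open>T\<close>, so that \<open>L2_set (($) v) T\<close> is its Euclidean norm.
\<close>

definition supp :: "real^'p \<Rightarrow> 'p set" where
  "supp v = {j. v $ j \<noteq> 0}"

definition sparse :: "nat \<Rightarrow> real^'p \<Rightarrow> bool" where
  "sparse m v \<longleftrightarrow> card (supp v) \<le> m"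

definition l1_norm_on :: "real^'p \<Rightarrow> 'p set \<Rightarrow> real" where
  "l1_norm_on v T = (\<Sum>j\<in>T. \<bar>v $ j\<bar>)"

text \<open>The vector \<open>\<beta>\<^sup>\<natural>(T)\<close>.\<close>

definition zero_off :: "'p set \<Rightarrow> real^'p \<Rightarrow> real^'p" where
  "zero_off T v = (\<chi> j. if j \<in> T then v $ j else 0)"

text \<open>\<open>X\<^sub>T v\<^sub>T\<close>; only the entries of \<open>v\<close> in \<open>T\<close> enter.\<close>

definition submatrix_mult :: "real^'p^'n \<Rightarrow> 'p set \<Rightarrow> real^'p \<Rightarrow> real^'n" where
  "submatrix_mult X T v = (\<Sum>j\<in>T. v $ j *\<^sub>R column j X)"

definition lam :: "real^'p^'n \<Rightarrow> real" where
  "lam X = sqrt (2 * ln (real CARD('p)) / real CARD('n))"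

definition essential_sparsity :: "real^'p^'n \<Rightarrow> real \<Rightarrow> real^'p \<Rightarrow> nat" where
  "essential_sparsity X \<sigma> \<beta> =
     (LEAST k. (\<Sum>i\<in>UNIV. min ((\<beta> $ i)\<^sup>2) ((lam X)\<^sup>2 * \<sigma>\<^sup>2)) \<le> real k * (lam X)\<^sup>2 * \<sigma>\<^sup>2)"

text \<open>Ties are broken arbitrarily, hence a predicate rather than a function.\<close>

definition largest_positions :: "real^'p \<Rightarrow> nat \<Rightarrow> 'p set \<Rightarrow> bool" where
  "largest_positions \<beta> k T \<longleftrightarrow> card T = k \<and> (\<forall>i\<in>T. \<forall>j\<in>-T. \<bar>\<beta> $ j\<bar> \<le> \<bar>\<beta> $ i\<bar>)"

text \<open>
  The extrema below are written as \<open>Sup\<close> and \<open>Inf\<close>. For positive sparsity levels they are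
  attained, the quotients being homogeneous and continuous on compact pieces of the unit sphere.
\<close>

definition sparse_quotients :: "real^'p^'n \<Rightarrow> nat \<Rightarrow> real set" where
  "sparse_quotients X m =
     {(norm (X *v v))\<^sup>2 / (real CARD('n) * (norm v)\<^sup>2) | v. v \<noteq> 0 \<and> sparse m v}"

definition Lambda_max :: "real^'p^'n \<Rightarrow> nat \<Rightarrow> real" where
  "Lambda_max X m = (if m = 0 then 0 else Sup (sparse_quotients X m))"

definition Lambda_min :: "real^'p^'n \<Rightarrow> nat \<Rightarrow> real" where
  "Lambda_min X m = Inf (sparse_quotients X m)"

definition restricted_orth :: "real^'p^'n \<Rightarrow> nat \<Rightarrow> nat \<Rightarrow> real" where
  "restricted_orth X m m' =
     Inf {t. \<forall>T T' v v'. T \<inter> T' = {} \<and> card T \<le> m \<and> card T' \<le> m' \<longrightarrow>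
            \<bar>submatrix_mult X T v \<bullet> submatrix_mult X T' v'\<bar> / real CARD('n)
              \<le> t * L2_set (($) v) T * L2_set (($) v') T'}"

text \<open>
  \<open>RE_min X m k0\<close> is \<open>1 / K(m, k0)\<close>. In its index set \<open>v \<noteq> 0\<close> and the cone condition force
  \<open>v\<^sub>J \<noteq> 0\<close>, so no division by zero occurs.
\<close>

definition RE_min :: "real^'p^'n \<Rightarrow> nat \<Rightarrow> real \<Rightarrow> real" where
  "RE_min X m k0 =
     Inf {norm (X *v v) / (sqrt (real CARD('n)) * L2_set (($) v) J) | J v.
            card J \<le> m \<and> v \<noteq> 0 \<and> l1_norm_on v (-J) \<le> k0 * l1_norm_on v J}"

definition RE :: "nat \<Rightarrow> real \<Rightarrow> real^'p^'n \<Rightarrow> bool" where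
  "RE m k0 X \<longleftrightarrow> m \<in> {1..CARD('p)} \<and> k0 > 0 \<and> RE_min X m k0 > 0"

definition RE_K :: "real^'p^'n \<Rightarrow> nat \<Rightarrow> real \<Rightarrow> real" where
  "RE_K X m k0 = 1 / RE_min X m k0"

definition lam_noise :: "real^'p^'n \<Rightarrow> real \<Rightarrow> real \<Rightarrow> real" where
  "lam_noise X \<sigma> a = \<sigma> * sqrt (1 + a) * sqrt (2 * ln (real CARD('p)) / real CARD('n))"

definition noise_event :: "real^'p^'n \<Rightarrow> real \<Rightarrow> real \<Rightarrow> (real^'n) set" where
  "noise_event X \<sigma> a =
     {e. infnorm ((1 / real CARD('n)) *\<^sub>R (transpose X *v e)) \<le> lam_noise X \<sigma> a}"

definition lasso_objective :: "real^'p^'n \<Rightarrow> real^'n \<Rightarrow> real \<Rightarrow> real^'p \<Rightarrow> real" where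
  "lasso_objective X y lam_n b =
     1 / (2 * real CARD('n)) * (norm (y - X *v b))\<^sup>2 + lam_n * l1_norm_on b UNIV"

definition lasso_solution :: "real^'p^'n \<Rightarrow> real^'n \<Rightarrow> real \<Rightarrow> real^'p \<Rightarrow> bool" where
  "lasso_solution X y lam_n b \<longleftrightarrow> is_arg_min (lasso_objective X y lam_n) (\<lambda>_. True) b"

text \<open>The law \<open>N(0, \<sigma>\<^sup>2 I\<^sub>n)\<close>, given by its Lebesgue density.\<close>

definition isotropic_gaussian :: "'w measure \<Rightarrow> ('w \<Rightarrow> real^'n) \<Rightarrow> real \<Rightarrow> bool" where
  "isotropic_gaussian M \<epsilon> \<sigma> \<longleftrightarrow>
     distributed M lborel \<epsilon> (\<lambda>x. ennreal (\<Prod>i\<in>UNIV. normal_density 0 \<sigma> (x $ i)))"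

definition ell :: "real^'p^'n \<Rightarrow> nat \<Rightarrow> real" where
  "ell X s0 =
     min (restricted_orth X s0 (2 * s0) / sqrt (Lambda_min X (2 * s0))) (sqrt (Lambda_max X s0))"

text \<open>Truncation in \<open>s - s0\<close> is harmless: the essential sparsity never exceeds \<open>s\<close>.\<close>

definition const_D :: "real^'p^'n \<Rightarrow> nat \<Rightarrow> nat \<Rightarrow> real \<Rightarrow> real" where
  "const_D X s s0 d0 =
     sqrt (Lambda_max X (s - s0) / Lambda_min X (2 * s0))
       * (1 + 3 * ell X s0 * sqrt (Lambda_max X (s - s0)) / d0)"

definition const_D0 :: "real^'p^'n \<Rightarrow> nat \<Rightarrow> nat \<Rightarrow> real \<Rightarrow> real" where
  "const_D0 X s s0 d0 =
     max (const_D X s s0 d0)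
       (sqrt 2 * (d0 * (RE_K X s0 4)\<^sup>2 + RE_K X s0 3 * sqrt (Lambda_max X (s - s0))
                  + 2 * d0 * (RE_K X s0 3)\<^sup>2))"

definition const_D1 :: "real^'p^'n \<Rightarrow> nat \<Rightarrow> nat \<Rightarrow> real \<Rightarrow> real" where
  "const_D1 X s s0 d0 =
     d0 * max (max (Lambda_max X (s - s0) / d0\<^sup>2 + 9 / 4 * (RE_K X s0 3)\<^sup>2)
                   (4 * (RE_K X s0 4)\<^sup>2))
              (3 * Lambda_max X (s - s0) / d0\<^sup>2)"

definition const_D2 :: "real^'p^'n \<Rightarrow> nat \<Rightarrow> nat \<Rightarrow> real \<Rightarrow> real" where
  "const_D2 X s s0 d0 =
     d0 * max (max (Lambda_max X (s - s0) / d0\<^sup>2 + 4 * (RE_K X s0 3)\<^sup>2)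
                   (5 * (RE_K X s0 4)\<^sup>2))
              (4 * Lambda_max X (s - s0) / d0\<^sup>2)"

definition const_D3 :: "real^'p^'n \<Rightarrow> nat \<Rightarrow> nat \<Rightarrow> real \<Rightarrow> real" where
  "const_D3 X s s0 d0 =
     sqrt (Lambda_max X (s - s0)) + d0 * RE_K X s0 4 / 2 + d0 * RE_K X s0 3"

end

theory Submission
  imports Defs
begin

text \<open>
  On the noise event the argument is deterministic. Optimality of the Lasso along the segment towards \<open>\<beta>\<^sup>\<natural>(T)\<close> gives, for \<open>h\<close> the difference of the two vectors and
  with \<open>W\<close>, \<open>V\<close>, \<open>A\<close> for the norms of the images of \<open>\<beta>_init - \<beta>\<close>, of \<open>h\<close> and of
  \<open>\<beta> - \<beta>\<^sup>\<natural>(T)\<close>, all divided by \<open>sqrt n\<close>, the basic inequality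
  \<open>W\<^sup>2 + V\<^sup>2 + lam_n * \<parallel>h\<^bsub>-T\<^esub>\<parallel>\<^sub>1 \<le> A\<^sup>2 + 3 * lam_n * \<parallel>h\<^bsub>T\<^esub>\<parallel>\<^sub>1\<close>
  (\<open>lasso_basic_inequality\<close>). The term \<open>V\<^sup>2\<close>, which comparing the objective at the two endpoints
  would not give, is what produces the stated constants.

  Prediction: unless \<open>W \<le> A\<close>, the vector \<open>h\<close> lies in the cone with parameter three, hence
  \<open>\<parallel>h\<^bsub>T\<^esub>\<parallel>\<^sub>1 \<le> sqrt \<bar>T\<bar> * K * V\<close>, and completing the square in \<open>V\<close> bounds \<open>W\<close>. For
  \<open>T = I\<^sub>0\<close> this is the last claim, and for \<open>T = T\<^sub>0\<close> it is the bound with \<open>D\<^sub>3\<close>, because the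
  definition of essential sparsity keeps \<open>\<beta>\<close> off \<open>T\<^sub>0\<close> below \<open>\<lambda> \<sigma> sqrt s\<^sub>0\<close> in norm
  (\<open>norm_off_largest_positions\<close>), so that \<open>A\<close> is at most \<open>sqrt (Lambda_max X (s - s0))\<close> times
  this scale.

  Norms of \<open>h\<close>: three regimes are distinguished by the ratio of the \<open>\<ell>\<^sub>1\<close> norms of \<open>h\<close> off and
  on \<open>T\<^sub>0\<close>. Up to three and up to four, \<open>h\<close> lies in a cone on which a restricted eigenvalue is
  available; beyond four, the basic inequality and \<open>A \<le> V + W\<close> bound both penalties by a
  multiple of \<open>A\<^sup>2\<close>. These
  regimes account for the entries of the maxima \<open>D\<^sub>1\<close> and \<open>D\<^sub>2\<close>.

  For the Euclidean norm, let \<open>T\<^sub>1\<close> hold the \<open>s\<^sub>0\<close> largest entries of \<open>h\<close> off \<open>T\<^sub>0\<close>. The tail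
  beyond \<open>T\<^sub>0 \<union> T\<^sub>1\<close> is bounded by the \<open>\<ell>\<^sub>1\<close> norm off \<open>T\<^sub>0\<close> divided by \<open>sqrt s\<^sub>0\<close>
  (\<open>greedy_tail_bound\<close>), whence \<open>D\<^sub>1\<close>.
  Inside a cone, the head on \<open>T\<^sub>0 \<union> T\<^sub>1\<close> consists of two sets to each of which the restricted
  eigenvalue applies (\<open>RE_min_bound_any_set\<close>), which explains the factor \<open>sqrt 2\<close> in \<open>D\<^sub>0\<close>.
  When \<open>A\<close> dominates, the sparse eigenvalue \<open>Lambda_min\<close> is used instead, and the interaction of
  head and tail costs \<open>ell\<close> (\<open>norm_head_le\<close>); this is the part \<open>D\<close> of \<open>D\<^sub>0\<close>.
\<close>

section \<open>Largest entries and greedy tails\<close>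

lemma ex_largest_subset:
  fixes f :: "'a \<Rightarrow> real"
  assumes "finite A" and "k \<le> card A"
  shows "\<exists>B\<subseteq>A. card B = k \<and> (\<forall>i\<in>B. \<forall>j\<in>A - B. f j \<le> f i)"
  using assms(2)
proof (induction k)
  case 0
  then show ?case by (intro exI[of _ "{}"]) auto
next
  case (Suc k)
  then obtain B where B: "B \<subseteq> A" "card B = k" "\<forall>i\<in>B. \<forall>j\<in>A - B. f j \<le> f i"
    by auto
  have finB: "finite B"
    using B(1) assms(1) finite_subset by blast
  have "card (A - B) > 0"
    using Suc.prems B finB by (simp add: card_Diff_subset)
  then have ne: "A - B \<noteq> {}" by (metis card.empty less_irrefl)
  have "Max (f ` (A - B)) \<in> f ` (A - B)"
    using ne assms(1) by (intro Max_in) auto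
  then obtain x where x: "x \<in> A - B" "f x = Max (f ` (A - B))" by auto
  have mx: "f j \<le> f x" if "j \<in> A - B" for j
    using that x(2) assms(1) by (simp add: Max_ge)
  show ?case
  proof (intro exI[of _ "insert x B"] conjI)
    show "insert x B \<subseteq> A" using B x by auto
    show "card (insert x B) = Suc k" using B x finB by auto
    show "\<forall>i\<in>insert x B. \<forall>j\<in>A - insert x B. f j \<le> f i" using B mx by auto
  qed
qed

text \<open>Every index of \<open>B\<close> outside \<open>J\<close> can be exchanged for its own index of \<open>J\<close> outside \<open>B\<close>,
  which carries at least as much weight.\<close>

lemma sum_le_sum_largest:
  fixes g :: "'a \<Rightarrow> real"
  assumes fin: "finite B" "finite J" and card: "card B \<le> card J"
    and nonneg: "\<And>j. 0 \<le> g j"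
    and largest: "\<And>i j. i \<in> J \<Longrightarrow> j \<in> B - J \<Longrightarrow> g j \<le> g i"
  shows "sum g B \<le> sum g J"
proof -
  have "card (B - J) \<le> card (J - B)"
    using card fin by (simp add: card_Diff_subset_Int Int_commute diff_le_mono)
  then obtain f where f: "f ` (B - J) \<subseteq> J - B" "inj_on f (B - J)"
    using fin by (meson card_le_inj finite_Diff)
  have "sum g (B - J) \<le> (\<Sum>x\<in>B - J. g (f x))"
    using f by (intro sum_mono largest) auto
  also have "\<dots> = sum g (f ` (B - J))"
    using f(2) by (simp add: sum.reindex)
  also have "\<dots> \<le> sum g (J - B)"
    using f(1) fin nonneg by (intro sum_mono2) auto
  finally have *: "sum g (B - J) \<le> sum g (J - B)" .
  have "sum g B = sum g (B - J) + sum g (B \<inter> J)"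
    using fin by (simp add: sum.Int_Diff[of B g J])
  also have "\<dots> \<le> sum g (J - B) + sum g (J \<inter> B)"
    using * by (simp add: Int_commute)
  also have "\<dots> = sum g J"
    using fin by (simp add: sum.Int_Diff[of J g B])
  finally show ?thesis .
qed

lemma L2_set_le_card:
  fixes f :: "'a \<Rightarrow> real"
  assumes "card B \<le> m" and "0 \<le> t" and "\<And>j. j \<in> B \<Longrightarrow> \<bar>f j\<bar> \<le> t"
  shows "L2_set f B \<le> sqrt (real m) * t"
proof -
  have "(\<Sum>j\<in>B. (f j)\<^sup>2) \<le> (\<Sum>j\<in>B. t\<^sup>2)"
    using assms by (intro sum_mono) (metis abs_ge_zero power2_abs power_mono)
  also have "\<dots> \<le> real m * t\<^sup>2"
    using assms(1) by (simp add: mult_right_mono)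
  finally have "sqrt (\<Sum>j\<in>B. (f j)\<^sup>2) \<le> sqrt (real m * t\<^sup>2)" by simp
  then show ?thesis
    using assms(2) by (simp add: L2_set_def real_sqrt_mult)
qed

lemma l1_le_sqrt_card_L2:
  fixes f :: "'a \<Rightarrow> real"
  assumes "card B \<le> m"
  shows "(\<Sum>j\<in>B. \<bar>f j\<bar>) \<le> sqrt (real m) * L2_set f B"
proof -
  have "(\<Sum>j\<in>B. \<bar>1::real\<bar> * \<bar>f j\<bar>) \<le> L2_set (\<lambda>_. 1) B * L2_set f B"
    by (rule L2_set_mult_ineq)
  also have "\<dots> \<le> sqrt (real m) * L2_set f B"
    using assms by (intro mult_right_mono) (auto simp: L2_set_def intro: sum_nonneg)
  finally show ?thesis by simp
qed

text \<open>
  Customarily one splits the indices into consecutive blocks \<open>B\<^sub>1, B\<^sub>2, \<dots>\<close> of \<open>m\<close> entries in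
  decreasing order. No entry of a block exceeds the average of the block before it, so that the
  \<open>\<ell>\<^sub>2\<close> norm of a block is at most \<open>1 / sqrt m\<close> times the \<open>\<ell>\<^sub>1\<close> norm of its
  predecessor, and these bounds add up. The induction peels off one block at a time. It is
  carried out for a subadditive \<open>F\<close>, since the tail is measured below by its own norm, by the
  norm of its image and by its inner product with the image of the head.
\<close>

lemma greedy_tail_bound:
  fixes f :: "'a \<Rightarrow> real" and F :: "'a set \<Rightarrow> real"
  assumes m: "0 < m" and c: "0 \<le> c"
    and subadd: "\<And>B C. B \<subseteq> \<Omega> \<Longrightarrow> C \<subseteq> \<Omega> \<Longrightarrow> B \<inter> C = {} \<Longrightarrow> F (B \<union> C) \<le> F B + F C"
    and small: "\<And>B. B \<subseteq> \<Omega> \<Longrightarrow> card B \<le> m \<Longrightarrow> F B \<le> c * L2_set f B"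
    and "finite A" and "B \<subseteq> A" and "A - B \<subseteq> \<Omega>"
    and "\<forall>i\<in>B. \<forall>j\<in>A - B. \<bar>f j\<bar> \<le> \<bar>f i\<bar>"
    and "card B = min m (card A)"
  shows "F (A - B) \<le> c * ((\<Sum>j\<in>A. \<bar>f j\<bar>) / sqrt (real m))"
  using assms(5-)
proof (induction "card A" arbitrary: A B rule: less_induct)
  case less
  let ?R = "A - B"
  show ?case
  proof (cases "?R = {}")
    case True
    have "F ?R \<le> 0" unfolding True using small[of "{}"] by simp
    also have "0 \<le> c * ((\<Sum>j\<in>A. \<bar>f j\<bar>) / sqrt (real m))" using c by (simp add: sum_nonneg)
    finally show ?thesis .
  next
    case False
    have larger: "card B < card A"
      using False less.prems(1,2) by (intro psubset_card_mono) auto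
    then have card: "card B = m" using less.prems(5) by simp
    have "card ?R < card A"
      using m card larger less.prems(1,2) by (simp add: card_Diff_subset finite_subset)
    define t where "t = (\<Sum>i\<in>B. \<bar>f i\<bar>) / real m"
    have t_ge: "\<bar>f j\<bar> \<le> t" if j: "j \<in> ?R" for j
    proof -
      have "real m * \<bar>f j\<bar> = (\<Sum>i\<in>B. \<bar>f j\<bar>)" using card by simp
      also have "\<dots> \<le> (\<Sum>i\<in>B. \<bar>f i\<bar>)" using less.prems(4) j by (intro sum_mono) auto
      finally show ?thesis using m by (simp add: t_def field_simps)
    qed
    obtain C where C: "C \<subseteq> ?R" "card C = min m (card ?R)" "\<forall>i\<in>C. \<forall>j\<in>?R - C. \<bar>f j\<bar> \<le> \<bar>f i\<bar>"
      using ex_largest_subset[of ?R "min m (card ?R)" "\<lambda>j. \<bar>f j\<bar>"] less.prems(1) by auto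
    have C_small: "card C \<le> m" using C(2) by simp
    have "F C \<le> c * L2_set f C"
      using C(1) C_small less.prems(3) by (intro small) auto
    also have "\<dots> \<le> c * (sqrt (real m) * t)"
      using c C(1) t_ge by (intro mult_left_mono L2_set_le_card[OF C_small])
        (auto simp: t_def sum_nonneg)
    also have "sqrt (real m) * t = (\<Sum>i\<in>B. \<bar>f i\<bar>) / sqrt (real m)"
      using m by (simp add: t_def field_simps flip: real_sqrt_mult)
    finally have block: "F C \<le> c * ((\<Sum>i\<in>B. \<bar>f i\<bar>) / sqrt (real m))" .
    have rest: "F (?R - C) \<le> c * ((\<Sum>j\<in>?R. \<bar>f j\<bar>) / sqrt (real m))"
      using C less.prems(1,3) by (intro less.hyps[OF \<open>card ?R < card A\<close>]) auto
    have "F ?R = F (C \<union> (?R - C))" using C(1) by (simp add: Un_absorb1)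
    also have "\<dots> \<le> F C + F (?R - C)" using C(1) less.prems(3) by (intro subadd) auto
    also have "\<dots> \<le> c * ((\<Sum>i\<in>B. \<bar>f i\<bar>) / sqrt (real m)) + c * ((\<Sum>j\<in>?R. \<bar>f j\<bar>) / sqrt (real m))"
      using block rest by (rule add_mono)
    also have "\<dots> = c * ((\<Sum>j\<in>A. \<bar>f j\<bar>) / sqrt (real m))"
      using sum.subset_diff[OF less.prems(2,1), of "\<lambda>j. \<bar>f j\<bar>"]
      by (simp add: add_divide_distrib distrib_left add.commute)
    finally show ?thesis .
  qed
qed

section \<open>Restrictions of vectors and their images\<close>

lemma norm_zero_off: "norm (zero_off T v) = L2_set (($) v) T"
proof -
  have "(\<Sum>j\<in>UNIV. (norm (zero_off T v $ j))\<^sup>2) = (\<Sum>j\<in>T. (v $ j)\<^sup>2)"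
    by (rule sum.mono_neutral_cong_right) (auto simp: zero_off_def)
  then show ?thesis by (simp add: norm_vec_def L2_set_def)
qed

lemma zero_off_Un_disjoint:
  "A \<inter> B = {} \<Longrightarrow> zero_off (A \<union> B) v = zero_off A v + zero_off B v"
  by (auto simp: zero_off_def vec_eq_iff)

lemma zero_off_Compl: "zero_off T v + zero_off (-T) v = v"
  by (auto simp: zero_off_def vec_eq_iff)

lemma sparse_zero_off: "card T \<le> m \<Longrightarrow> sparse m (zero_off T v)"
  unfolding sparse_def supp_def zero_off_def
  by (rule order.trans[OF card_mono[of T]]) (auto split: if_splits)

lemma submatrix_mult_eq: "submatrix_mult X T v = X *v zero_off T v"
proof -
  have "X *v zero_off T v = (\<Sum>j\<in>UNIV. zero_off T v $ j *\<^sub>R column j X)"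
    by (simp add: matrix_mult_sum scalar_mult_eq_scaleR)
  also have "\<dots> = (\<Sum>j\<in>T. v $ j *\<^sub>R column j X)"
    by (rule sum.mono_neutral_cong_right) (auto simp: zero_off_def)
  finally show ?thesis by (simp add: submatrix_mult_def)
qed

lemma norm_eq_L2_set: "norm v = L2_set (($) v) UNIV" for v :: "real^'p"
  by (simp add: norm_vec_def L2_set_def)

lemma norm_power2_split:
  fixes v :: "real^'p"
  shows "(norm v)\<^sup>2 = (L2_set (($) v) T)\<^sup>2 + (L2_set (($) v) (-T))\<^sup>2"
  unfolding norm_eq_L2_set using sum.subset_diff[of T UNIV "\<lambda>j. (v $ j)\<^sup>2"]
  by (simp add: L2_set_def sum_nonneg Compl_eq_Diff_UNIV)

lemma L2_set_Un_power2:
  fixes f :: "'a \<Rightarrow> real"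
  assumes "finite A" "finite B" "A \<inter> B = {}"
  shows "(L2_set f (A \<union> B))\<^sup>2 = (L2_set f A)\<^sup>2 + (L2_set f B)\<^sup>2"
  using assms by (simp add: L2_set_def sum_nonneg sum.union_disjoint)

text \<open>Linear maps between finite-dimensional spaces are bounded, which keeps every supremum
  over sparse vectors finite.\<close>

lemma matrix_mult_bounded:
  fixes X :: "real^'p^'n"
  obtains c where "0 < c" "\<And>v. norm (X *v v) \<le> c * norm v"
  using bounded_linear.pos_bounded[OF matrix_vector_mul_bounded_linear[of X]]
  by (metis mult.commute)

section \<open>Sparse eigenvalues\<close>

lemma sparse_axis: "0 < m \<Longrightarrow> sparse m (axis j 1)"
proof -
  have "supp (axis j (1::real)) = {j}" by (auto simp: supp_def axis_def)
  then show "0 < m \<Longrightarrow> sparse m (axis j 1)" by (simp add: sparse_def)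
qed

lemma bdd_above_sparse_quotients:
  fixes X :: "real^'p^'n"
  shows "bdd_above (sparse_quotients X m)"
proof -
  obtain c where c: "0 < c" "\<And>v. norm (X *v v) \<le> c * norm v"
    using matrix_mult_bounded by blast
  have "q \<le> c\<^sup>2 / real CARD('n)" if q: "q \<in> sparse_quotients X m" for q
  proof -
    obtain v where v: "q = (norm (X *v v))\<^sup>2 / (real CARD('n) * (norm v)\<^sup>2)" "v \<noteq> 0"
      using q by (auto simp: sparse_quotients_def)
    have "(norm (X *v v))\<^sup>2 \<le> (c * norm v)\<^sup>2" using c by (intro power_mono) auto
    then have "q * (norm v)\<^sup>2 \<le> c\<^sup>2 / real CARD('n) * (norm v)\<^sup>2"
      using v by (simp add: field_simps power_mult_distrib)
    then show ?thesis using v(2) by (rule_tac mult_right_le_imp_le) auto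
  qed
  then show ?thesis by (intro bdd_aboveI)
qed

lemma sparse_quotients_nonneg: "q \<in> sparse_quotients X m \<Longrightarrow> 0 \<le> q"
  by (auto simp: sparse_quotients_def)

lemma sparse_quotients_nonempty:
  fixes X :: "real^'p^'n"
  shows "0 < m \<Longrightarrow> sparse_quotients X m \<noteq> {}"
proof -
  assume "0 < m"
  then have "axis undefined 1 \<noteq> (0 :: real^'p) \<and> sparse m (axis undefined 1 :: real^'p)"
    by (simp add: sparse_axis axis_eq_0_iff)
  then show ?thesis unfolding sparse_quotients_def by blast
qed

lemma Lambda_max_nonneg: "0 \<le> Lambda_max X m"
proof (cases "m = 0")
  case False
  then obtain q where "q \<in> sparse_quotients X m"
    using sparse_quotients_nonempty[of m X] by auto
  then have "0 \<le> Sup (sparse_quotients X m)"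
    using cSup_upper2[OF _ sparse_quotients_nonneg bdd_above_sparse_quotients] by blast
  then show ?thesis by (simp add: Lambda_max_def)
qed (simp add: Lambda_max_def)

lemma norm_matrix_mult_le_Lambda_max:
  fixes X :: "real^'p^'n"
  assumes "sparse m v"
  shows "norm (X *v v) / sqrt (real CARD('n)) \<le> sqrt (Lambda_max X m) * norm v"
proof (cases "v = 0")
  case False
  then have "supp v \<noteq> {}" by (auto simp: supp_def vec_eq_iff)
  then have m: "m \<noteq> 0" using assms by (auto simp: sparse_def)
  have "(norm (X *v v))\<^sup>2 / (real CARD('n) * (norm v)\<^sup>2) \<le> Lambda_max X m"
    unfolding Lambda_max_def using m False assms
    using bdd_above_sparse_quotients[of X m]
    by (auto intro!: cSup_upper simp: sparse_quotients_def)
  then have "(norm (X *v v))\<^sup>2 / real CARD('n) \<le> Lambda_max X m * (norm v)\<^sup>2"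
    using False by (simp add: field_simps)
  then have "sqrt ((norm (X *v v))\<^sup>2 / real CARD('n)) \<le> sqrt (Lambda_max X m * (norm v)\<^sup>2)"
    by simp
  then show ?thesis by (simp add: real_sqrt_divide real_sqrt_mult)
qed simp

lemma Lambda_min_le_norm_matrix_mult:
  fixes X :: "real^'p^'n"
  assumes "sparse m v"
  shows "sqrt (Lambda_min X m) * norm v \<le> norm (X *v v) / sqrt (real CARD('n))"
proof (cases "v = 0")
  case False
  have "bdd_below (sparse_quotients X m)"
    using sparse_quotients_nonneg by (rule bdd_belowI)
  then have "Lambda_min X m \<le> (norm (X *v v))\<^sup>2 / (real CARD('n) * (norm v)\<^sup>2)"
    unfolding Lambda_min_def using False assms
    by (auto intro!: cInf_lower simp: sparse_quotients_def)
  then have "Lambda_min X m * (norm v)\<^sup>2 \<le> (norm (X *v v))\<^sup>2 / real CARD('n)"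
    using False by (simp add: field_simps)
  then have "sqrt (Lambda_min X m * (norm v)\<^sup>2) \<le> sqrt ((norm (X *v v))\<^sup>2 / real CARD('n))"
    by simp
  then show ?thesis by (simp add: real_sqrt_divide real_sqrt_mult)
qed simp

section \<open>Restricted orthogonality\<close>

lemma restricted_orth_bounded:
  fixes X :: "real^'p^'n"
  shows "\<exists>t. \<forall>T T' v v'. T \<inter> T' = {} \<and> card T \<le> m \<and> card T' \<le> m' \<longrightarrow>
            \<bar>submatrix_mult X T v \<bullet> submatrix_mult X T' v'\<bar> / real CARD('n)
              \<le> t * L2_set (($) v) T * L2_set (($) v') T'"
proof -
  obtain c where c: "0 < c" "\<And>v. norm (X *v v) \<le> c * norm v"
    using matrix_mult_bounded by blast
  have "\<bar>submatrix_mult X T v \<bullet> submatrix_mult X T' v'\<bar> / real CARD('n)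
          \<le> (c * c / real CARD('n)) * L2_set (($) v) T * L2_set (($) v') T'" for T T' v v'
  proof -
    have "\<bar>submatrix_mult X T v \<bullet> submatrix_mult X T' v'\<bar>
        \<le> norm (submatrix_mult X T v) * norm (submatrix_mult X T' v')"
      by (rule Cauchy_Schwarz_ineq2)
    also have "\<dots> \<le> (c * L2_set (($) v) T) * (c * L2_set (($) v') T')"
      unfolding submatrix_mult_eq norm_zero_off[symmetric]
      using c by (intro mult_mono) auto
    finally show ?thesis by (simp add: divide_simps mult_ac)
  qed
  then show ?thesis by blast
qed

lemma restricted_orth_le:
  fixes X :: "real^'p^'n"
  assumes "T \<inter> T' = {}" "card T \<le> m" "card T' \<le> m'"
  shows "\<bar>submatrix_mult X T v \<bullet> submatrix_mult X T' v'\<bar> / real CARD('n)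
          \<le> restricted_orth X m m' * L2_set (($) v) T * L2_set (($) v') T'"
proof -
  let ?P = "L2_set (($) v) T * L2_set (($) v') T'"
  let ?q = "\<bar>submatrix_mult X T v \<bullet> submatrix_mult X T' v'\<bar> / real CARD('n)"
  show ?thesis
  proof (cases "?P = 0")
    case True
    obtain t where "?q \<le> t * L2_set (($) v) T * L2_set (($) v') T'"
      using restricted_orth_bounded[of m m' X] assms by blast
    then show ?thesis using True by (auto simp: mult.assoc)
  next
    case False
    then have P: "0 < ?P" by (simp add: less_le)
    have "?q / ?P \<le> restricted_orth X m m'"
      unfolding restricted_orth_def
    proof (rule cInf_greatest)
      fix t
      assume "t \<in> {t. \<forall>T T' v v'. T \<inter> T' = {} \<and> card T \<le> m \<and> card T' \<le> m' \<longrightarrow>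
            \<bar>submatrix_mult X T v \<bullet> submatrix_mult X T' v'\<bar> / real CARD('n)
              \<le> t * L2_set (($) v) T * L2_set (($) v') T'}"
      then have "?q \<le> t * ?P" using assms by (simp add: mult.assoc)
      then show "?q / ?P \<le> t" by (subst pos_divide_le_eq[OF P])
    qed (use restricted_orth_bounded[of m m' X] in blast)
    then have "?q \<le> restricted_orth X m m' * ?P" by (subst (asm) pos_divide_le_eq[OF P])
    then show ?thesis by (simp only: mult.assoc)
  qed
qed

lemma restricted_orth_nonneg:
  fixes X :: "real^'p^'n"
  assumes "2 \<le> CARD('p)" and "0 < m" and "0 < m'"
  shows "0 \<le> restricted_orth X m m'"
  unfolding restricted_orth_def
proof (rule cInf_greatest)
  obtain i j :: 'p where "i \<noteq> j"
    using assms(1) card_2_iff' by (metis UNIV_I card_le_Suc0_iff_eq finite not_less_eq_eq numeral_2_eq_2)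
  fix t
  assume "t \<in> {t. \<forall>T T' v v'. T \<inter> T' = {} \<and> card T \<le> m \<and> card T' \<le> m' \<longrightarrow>
            \<bar>submatrix_mult X T v \<bullet> submatrix_mult X T' v'\<bar> / real CARD('n)
              \<le> t * L2_set (($) v) T * L2_set (($) v') T'}"
  moreover have "{i} \<inter> {j} = {}" "card {i} \<le> m" "card {j} \<le> m'"
    using assms \<open>i \<noteq> j\<close> by auto
  ultimately have "\<bar>submatrix_mult X {i} (\<chi> k. 1) \<bullet> submatrix_mult X {j} (\<chi> k. 1)\<bar> / real CARD('n)
              \<le> t * L2_set (($) (\<chi> k. 1)) {i} * L2_set (($) (\<chi> k. 1)) {j}"
    by blast
  then have "\<bar>submatrix_mult X {i} (\<chi> k. 1) \<bullet> submatrix_mult X {j} (\<chi> k. 1)\<bar> / real CARD('n) \<le> t"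
    by (simp add: L2_set_def)
  then show "0 \<le> t" by (rule order.trans[rotated]) simp
qed (use restricted_orth_bounded[of m m' X] in blast)

section \<open>Restricted eigenvalues\<close>

lemma RE_min_bound:
  fixes X :: "real^'p^'n"
  assumes "0 < RE_min X m k0" "card J \<le> m" "l1_norm_on v (-J) \<le> k0 * l1_norm_on v J"
  shows "L2_set (($) v) J \<le> RE_K X m k0 * (norm (X *v v) / sqrt (real CARD('n)))"
proof (cases "L2_set (($) v) J = 0")
  case False
  then have pos: "0 < L2_set (($) v) J" by (simp add: less_le)
  then have "v \<noteq> 0" by (auto simp: L2_set_def)
  have "RE_min X m k0 \<le> norm (X *v v) / (sqrt (real CARD('n)) * L2_set (($) v) J)"
    unfolding RE_min_def
  proof (rule cInf_lower)
    show "bdd_below {norm (X *v v) / (sqrt (real CARD('n)) * L2_set (($) v) J) | J v.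
            card J \<le> m \<and> v \<noteq> 0 \<and> l1_norm_on v (-J) \<le> k0 * l1_norm_on v J}"
      by (rule bdd_belowI[of _ 0]) auto
  qed (use assms \<open>v \<noteq> 0\<close> in blast)
  then show ?thesis using pos assms(1) by (simp add: RE_K_def field_simps)
qed (use assms(1) in \<open>simp add: RE_K_def\<close>)

text \<open>A smaller cone parameter leaves fewer vectors in the cone; a coordinate vector lies in
  every cone, so that the infimum is not taken over the empty set.\<close>

lemma RE_min_antimono:
  fixes X :: "real^'p^'n"
  assumes "k0 \<le> k1" "0 \<le> k0" "0 < m"
  shows "RE_min X m k1 \<le> RE_min X m k0"
  unfolding RE_min_def
proof (rule cInf_superset_mono)
  let ?e = "axis undefined 1 :: real^'p"
  have "l1_norm_on ?e (-{undefined}) = 0"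
    by (auto simp: l1_norm_on_def axis_def intro!: sum.neutral)
  then have "?e \<noteq> 0 \<and> l1_norm_on ?e (-{undefined}) \<le> k0 * l1_norm_on ?e {undefined}"
    using assms by (simp add: l1_norm_on_def axis_eq_0_iff)
  moreover have "card {undefined :: 'p} \<le> m" using assms by simp
  ultimately show "{norm (X *v v) / (sqrt (real CARD('n)) * L2_set (($) v) J) | J v.
      card J \<le> m \<and> v \<noteq> 0 \<and> l1_norm_on v (-J) \<le> k0 * l1_norm_on v J} \<noteq> {}"
    by blast
  show "bdd_below {norm (X *v v) / (sqrt (real CARD('n)) * L2_set (($) v) J) | J v.
            card J \<le> m \<and> v \<noteq> 0 \<and> l1_norm_on v (-J) \<le> k1 * l1_norm_on v J}"
    by (rule bdd_belowI[of _ 0]) auto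
  have "l1_norm_on v (-J) \<le> k1 * l1_norm_on v J"
    if "l1_norm_on v (-J) \<le> k0 * l1_norm_on v J" for v J
    using that assms mult_right_mono[of k0 k1 "l1_norm_on v J"]
    by (simp add: l1_norm_on_def sum_nonneg)
  then show "{norm (X *v v) / (sqrt (real CARD('n)) * L2_set (($) v) J) | J v.
      card J \<le> m \<and> v \<noteq> 0 \<and> l1_norm_on v (-J) \<le> k0 * l1_norm_on v J}
    \<subseteq> {norm (X *v v) / (sqrt (real CARD('n)) * L2_set (($) v) J) | J v.
      card J \<le> m \<and> v \<noteq> 0 \<and> l1_norm_on v (-J) \<le> k1 * l1_norm_on v J}"
    by blast
qed

text \<open>
  The restricted eigenvalue only speaks about the entries on the set that defines the cone. The
  set \<open>J\<close> of the \<open>m\<close> largest entries of \<open>v\<close> defines a cone that still contains \<open>v\<close>, and no set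
  of at most \<open>m\<close> indices carries more of \<open>v\<close> than \<open>J\<close>.
\<close>

lemma RE_min_bound_any_set:
  fixes X :: "real^'p^'n"
  assumes "0 < RE_min X m k0" "0 \<le> k0" "m \<le> CARD('p)"
    and T: "card T \<le> m" "l1_norm_on v (-T) \<le> k0 * l1_norm_on v T"
    and B: "card B \<le> m"
  shows "L2_set (($) v) B \<le> RE_K X m k0 * (norm (X *v v) / sqrt (real CARD('n)))"
proof -
  obtain J where J: "card J = m" "\<forall>i\<in>J. \<forall>j\<in>UNIV - J. \<bar>v $ j\<bar> \<le> \<bar>v $ i\<bar>"
    using ex_largest_subset[of "UNIV :: 'p set" m "\<lambda>j. \<bar>v $ j\<bar>"] assms(3) by auto
  have l1: "l1_norm_on v T \<le> l1_norm_on v J"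
    unfolding l1_norm_on_def using J T by (intro sum_le_sum_largest) auto
  have split: "l1_norm_on v (-A) = l1_norm_on v UNIV - l1_norm_on v A" for A
    using sum.subset_diff[of A UNIV "\<lambda>j. \<bar>v $ j\<bar>"]
    by (simp add: l1_norm_on_def Compl_eq_Diff_UNIV)
  have "k0 * l1_norm_on v T \<le> k0 * l1_norm_on v J"
    using l1 assms(2) by (rule mult_left_mono)
  then have "l1_norm_on v (-J) \<le> k0 * l1_norm_on v J"
    using T(2) l1 split[of T] split[of J] by linarith
  then have bound: "L2_set (($) v) J \<le> RE_K X m k0 * (norm (X *v v) / sqrt (real CARD('n)))"
    using assms(1) J by (intro RE_min_bound) auto
  have "(\<Sum>j\<in>B. (v $ j)\<^sup>2) \<le> (\<Sum>j\<in>J. (v $ j)\<^sup>2)"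
    using J B by (intro sum_le_sum_largest) (auto simp: abs_le_square_iff)
  then have "L2_set (($) v) B \<le> L2_set (($) v) J" by (simp add: L2_set_def)
  with bound show ?thesis by linarith
qed

text \<open>A \<open>2 m\<close>-sparse vector lies in the cone with parameter one around its \<open>m\<close> largest entries,
  and consists of two pieces of at most \<open>m\<close> entries.\<close>

lemma Lambda_min_pos:
  fixes X :: "real^'p^'n"
  assumes re: "0 < RE_min X m k0" and k0: "1 \<le> k0" and m: "0 < m" "m \<le> CARD('p)"
  shows "0 < Lambda_min X (2 * m)"
proof -
  define K where "K = RE_K X m k0"
  have K: "0 < K" using re by (simp add: K_def RE_K_def)
  have "1 / (2 * K\<^sup>2) \<le> Lambda_min X (2 * m)"
    unfolding Lambda_min_def
  proof (rule cInf_greatest)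
    show "sparse_quotients X (2 * m) \<noteq> {}" using m by (intro sparse_quotients_nonempty) auto
    fix q
    assume "q \<in> sparse_quotients X (2 * m)"
    then obtain v where v: "q = (norm (X *v v))\<^sup>2 / (real CARD('n) * (norm v)\<^sup>2)"
        "v \<noteq> 0" "sparse (2 * m) v"
      by (auto simp: sparse_quotients_def)
    obtain J where J: "card J = m" "\<forall>i\<in>J. \<forall>j\<in>UNIV - J. \<bar>v $ j\<bar> \<le> \<bar>v $ i\<bar>"
      using ex_largest_subset[of "UNIV :: 'p set" m "\<lambda>j. \<bar>v $ j\<bar>"] m by auto
    define B where "B = supp v - J"
    have B: "card B \<le> m"
    proof (cases "J \<subseteq> supp v")
      case True
      then show ?thesis using v(3) J(1) by (simp add: B_def sparse_def card_Diff_subset)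
    next
      case False
      then obtain i where "i \<in> J" "v $ i = 0" by (auto simp: supp_def)
      then have "B = {}" using J(2) by (force simp: B_def supp_def)
      then show ?thesis by simp
    qed
    have off: "l1_norm_on v (-J) = l1_norm_on v B"
      unfolding l1_norm_on_def by (rule sum.mono_neutral_right) (auto simp: B_def supp_def)
    have "l1_norm_on v B \<le> l1_norm_on v J"
      unfolding l1_norm_on_def using J B by (intro sum_le_sum_largest) auto
    then have cone: "l1_norm_on v (-J) \<le> k0 * l1_norm_on v J"
      using off k0 mult_right_mono[OF k0, of "l1_norm_on v J"]
      by (simp add: l1_norm_on_def sum_nonneg)
    define V where "V = norm (X *v v) / sqrt (real CARD('n))"
    have "L2_set (($) v) J \<le> K * V" "L2_set (($) v) B \<le> K * V"
      unfolding K_def V_def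
      using RE_min_bound_any_set[OF re _ m(2) _ cone] J(1) B k0 by auto
    then have "(L2_set (($) v) J)\<^sup>2 + (L2_set (($) v) B)\<^sup>2 \<le> (K * V)\<^sup>2 + (K * V)\<^sup>2"
      by (intro add_mono power_mono) auto
    moreover have "L2_set (($) v) (-J) = L2_set (($) v) B"
      unfolding L2_set_def
      by (rule arg_cong[of _ _ sqrt], rule sum.mono_neutral_right) (auto simp: B_def supp_def)
    ultimately have "(norm v)\<^sup>2 \<le> 2 * K\<^sup>2 * V\<^sup>2"
      using norm_power2_split[of v J] by (simp add: power_mult_distrib)
    moreover have "V\<^sup>2 = q * (norm v)\<^sup>2" using v(2) by (simp add: v V_def power_divide)
    ultimately have "1 * (norm v)\<^sup>2 \<le> (q * (2 * K\<^sup>2)) * (norm v)\<^sup>2"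
      by (simp add: mult_ac)
    then have "1 \<le> q * (2 * K\<^sup>2)"
      by (rule mult_right_le_imp_le) (use v(2) in simp)
    then show "1 / (2 * K\<^sup>2) \<le> q" using K by (simp add: field_simps)
  qed
  moreover have "0 < 1 / (2 * K\<^sup>2)" using K by simp
  ultimately show ?thesis by linarith
qed

section \<open>Essential sparsity\<close>

lemma lam_pos:
  fixes X :: "real^'p^'n"
  assumes "2 \<le> CARD('p)"
  shows "0 < lam X"
  using assms by (simp add: lam_def)

lemma sum_min_le_card_supp:
  "(\<Sum>i\<in>UNIV. min ((\<beta> $ i)\<^sup>2) ((lam X)\<^sup>2 * \<sigma>\<^sup>2))
    \<le> real (card (supp \<beta>)) * (lam X)\<^sup>2 * \<sigma>\<^sup>2"
proof -
  have "(\<Sum>i\<in>UNIV. min ((\<beta> $ i)\<^sup>2) ((lam X)\<^sup>2 * \<sigma>\<^sup>2))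
      = (\<Sum>i\<in>supp \<beta>. min ((\<beta> $ i)\<^sup>2) ((lam X)\<^sup>2 * \<sigma>\<^sup>2))"
    by (rule sum.mono_neutral_right) (auto simp: supp_def)
  also have "\<dots> \<le> (\<Sum>i\<in>supp \<beta>. (lam X)\<^sup>2 * \<sigma>\<^sup>2)" by (intro sum_mono) auto
  finally show ?thesis by simp
qed

lemma essential_sparsity_le_card_supp: "essential_sparsity X \<sigma> \<beta> \<le> card (supp \<beta>)"
  unfolding essential_sparsity_def by (rule Least_le) (rule sum_min_le_card_supp)

lemma sum_min_le_essential_sparsity:
  "(\<Sum>i\<in>UNIV. min ((\<beta> $ i)\<^sup>2) ((lam X)\<^sup>2 * \<sigma>\<^sup>2))
    \<le> real (essential_sparsity X \<sigma> \<beta>) * (lam X)\<^sup>2 * \<sigma>\<^sup>2"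
  unfolding essential_sparsity_def by (rule LeastI) (rule sum_min_le_card_supp)

text \<open>Were some \<open>\<bar>\<beta>\<^sub>j\<bar>\<close> outside the \<open>s\<^sub>0\<close> largest entries above \<open>\<lambda> \<sigma>\<close>, then \<open>s\<^sub>0 + 1\<close> of the
  truncated squares would equal \<open>\<lambda>\<^sup>2 \<sigma>\<^sup>2\<close>. So the truncation is inactive off \<open>T\<^sub>0\<close>.\<close>

lemma norm_off_largest_positions:
  fixes X :: "real^'p^'n"
  assumes "2 \<le> CARD('p)" and "\<sigma> > 0"
    and T0: "largest_positions \<beta> (essential_sparsity X \<sigma> \<beta>) T0"
  shows "L2_set (($) \<beta>) (-T0) \<le> lam X * \<sigma> * sqrt (real (essential_sparsity X \<sigma> \<beta>))"
proof -
  define k where "k = essential_sparsity X \<sigma> \<beta>"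
  define P where "P = lam X * \<sigma>"
  have P: "0 < P" using lam_pos[OF assms(1), of X] assms(2) by (simp add: P_def)
  have P2: "(lam X)\<^sup>2 * \<sigma>\<^sup>2 = P\<^sup>2" by (simp add: P_def power_mult_distrib)
  have sum_le: "(\<Sum>i\<in>UNIV. min ((\<beta> $ i)\<^sup>2) (P\<^sup>2)) \<le> real k * P\<^sup>2"
    using sum_min_le_essential_sparsity[of \<beta> X \<sigma>] by (simp add: k_def P2 mult.assoc)
  have small: "(\<beta> $ j)\<^sup>2 \<le> P\<^sup>2" if j: "j \<in> -T0" for j
  proof (rule ccontr)
    assume "\<not> ?thesis"
    then have bigj: "P\<^sup>2 \<le> (\<beta> $ j)\<^sup>2" by simp
    have big: "P\<^sup>2 \<le> (\<beta> $ i)\<^sup>2" if "i \<in> insert j T0" for i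
    proof (cases "i = j")
      case False
      then have "\<bar>\<beta> $ j\<bar> \<le> \<bar>\<beta> $ i\<bar>"
        using that T0 j by (simp add: largest_positions_def)
      then show ?thesis using bigj by (simp add: abs_le_square_iff)
    qed (use bigj in simp)
    have "real (Suc k) * P\<^sup>2 = (\<Sum>i\<in>insert j T0. P\<^sup>2)"
      using T0 j by (simp add: largest_positions_def k_def)
    also have "\<dots> = (\<Sum>i\<in>insert j T0. min ((\<beta> $ i)\<^sup>2) (P\<^sup>2))"
      using big by (intro sum.cong refl) (simp add: min_absorb2)
    also have "\<dots> \<le> (\<Sum>i\<in>UNIV. min ((\<beta> $ i)\<^sup>2) (P\<^sup>2))"
      by (intro sum_mono2) auto
    also note sum_le
    finally have "real (Suc k) * P\<^sup>2 \<le> real k * P\<^sup>2" .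
    then show False using P by simp
  qed
  have "(\<Sum>i\<in>-T0. (\<beta> $ i)\<^sup>2) = (\<Sum>i\<in>-T0. min ((\<beta> $ i)\<^sup>2) (P\<^sup>2))"
    using small by (intro sum.cong) (auto simp: min_def)
  also have "\<dots> \<le> (\<Sum>i\<in>UNIV. min ((\<beta> $ i)\<^sup>2) (P\<^sup>2))"
    by (intro sum_mono2) auto
  finally have "sqrt (\<Sum>i\<in>-T0. (\<beta> $ i)\<^sup>2) \<le> sqrt (real k * P\<^sup>2)"
    using sum_le by simp
  then show ?thesis using P by (simp add: L2_set_def real_sqrt_mult k_def P_def mult.commute)
qed

text \<open>A zero of \<open>\<beta>\<close> among its \<open>k\<close> largest entries would leave fewer than \<open>k\<close> positions for the
  support, so \<open>T0\<close> lies in the support.\<close>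

lemma sparse_off_largest_positions:
  fixes \<beta> :: "real^'p"
  assumes T0: "largest_positions \<beta> k T0" and k: "k \<le> card (supp \<beta>)"
  shows "sparse (card (supp \<beta>) - k) (zero_off (-T0) \<beta>)"
proof -
  have "T0 \<subseteq> supp \<beta>"
  proof (rule ccontr)
    assume "\<not> T0 \<subseteq> supp \<beta>"
    then obtain i where i: "i \<in> T0" "\<beta> $ i = 0" by (auto simp: supp_def)
    then have "supp \<beta> \<subseteq> T0 - {i}"
      using T0 by (force simp: largest_positions_def supp_def)
    then have "card (supp \<beta>) \<le> card (T0 - {i})" by (intro card_mono) auto
    also have "\<dots> < card T0" using i by (intro psubset_card_mono) auto
    finally show False using T0 k by (simp add: largest_positions_def)
  qed
  then have "card (supp \<beta> - T0) = card (supp \<beta>) - k"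
    using T0 by (simp add: card_Diff_subset largest_positions_def)
  moreover have "supp (zero_off (-T0) \<beta>) = supp \<beta> - T0"
    by (auto simp: supp_def zero_off_def)
  ultimately show ?thesis by (simp add: sparse_def)
qed

section \<open>The basic inequality of the Lasso\<close>

lemma nonneg_if_small_perturbations_nonneg:
  fixes c q :: real
  assumes "\<And>t. 0 < t \<Longrightarrow> t \<le> 1 \<Longrightarrow> 0 \<le> c + t * q"
  shows "0 \<le> c"
proof (rule tendsto_lowerbound)
  show "((\<lambda>t. c + t * q) \<longlongrightarrow> c) (at_right 0)"
    by (auto intro!: tendsto_eq_intros)
  show "\<forall>\<^sub>F t in at_right 0. 0 \<le> c + t * q"
    using assms by (intro eventually_at_rightI[of 0 1]) auto
qed simp

text \<open>
  Optimality of \<open>b\<close> along the whole segment towards \<open>b'\<close>, and not only at its endpoint, is what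
  removes the quadratic term \<open>norm (X *v (b - b'))\<^sup>2\<close> from the right-hand side.
\<close>

lemma lasso_variational_inequality:
  fixes X :: "real^'p^'n"
  assumes sol: "lasso_solution X y g b" and g: "0 \<le> g"
  shows "((X *v b - y) \<bullet> (X *v (b - b'))) / real CARD('n)
          \<le> g * (l1_norm_on b' UNIV - l1_norm_on b UNIV)"
proof -
  define N where "N = real CARD('n)"
  have N: "0 < N" by (simp add: N_def)
  define z where "z = X *v (b - b')"
  define r where "r = y - X *v b"
  define l where "l = l1_norm_on b' UNIV - l1_norm_on b UNIV"
  have "0 \<le> (r \<bullet> z / N + g * l) + t * ((norm z)\<^sup>2 / (2 * N))" if t: "0 < t" "t \<le> 1" for t
  proof -
    let ?bt = "b - t *\<^sub>R (b - b')"
    have "y - X *v ?bt = r + t *\<^sub>R z"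
      by (simp add: r_def z_def matrix_vector_mult_diff_distrib matrix_vector_mult_scaleR algebra_simps)
    moreover have "lasso_objective X y g b \<le> lasso_objective X y g ?bt"
      using sol by (simp add: lasso_solution_def is_arg_min_linorder)
    ultimately have objective: "1 / (2 * N) * (norm r)\<^sup>2 + g * l1_norm_on b UNIV
        \<le> 1 / (2 * N) * (norm (r + t *\<^sub>R z))\<^sup>2 + g * l1_norm_on ?bt UNIV"
      by (simp only: lasso_objective_def N_def r_def)
    have square: "(norm (r + t *\<^sub>R z))\<^sup>2 = (norm r)\<^sup>2 + 2 * t * (r \<bullet> z) + t\<^sup>2 * (norm z)\<^sup>2"
      unfolding power2_norm_eq_inner
      by (simp add: inner_simps inner_commute algebra_simps power2_eq_square)
    have "l1_norm_on ?bt UNIV \<le> l1_norm_on b UNIV + t * l"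
    proof -
      have "\<bar>?bt $ j\<bar> \<le> (1 - t) * \<bar>b $ j\<bar> + t * \<bar>b' $ j\<bar>" for j
      proof -
        have "?bt $ j = (1 - t) * b $ j + t * b' $ j" by (simp add: algebra_simps)
        then show ?thesis using t abs_triangle_ineq[of "(1 - t) * b $ j" "t * b' $ j"]
          by (simp add: abs_mult)
      qed
      then have "l1_norm_on ?bt UNIV \<le> (\<Sum>j\<in>UNIV. (1 - t) * \<bar>b $ j\<bar> + t * \<bar>b' $ j\<bar>)"
        unfolding l1_norm_on_def by (intro sum_mono)
      also have "\<dots> = (1 - t) * l1_norm_on b UNIV + t * l1_norm_on b' UNIV"
        by (simp only: l1_norm_on_def sum.distrib sum_distrib_left)
      finally show ?thesis by (simp add: l_def algebra_simps)
    qed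
    then have "g * l1_norm_on ?bt UNIV \<le> g * (l1_norm_on b UNIV + t * l)"
      using g by (rule mult_left_mono)
    with objective have "1 / (2 * N) * (norm r)\<^sup>2 + g * l1_norm_on b UNIV
       \<le> 1 / (2 * N) * ((norm r)\<^sup>2 + 2 * t * (r \<bullet> z) + t\<^sup>2 * (norm z)\<^sup>2) + g * (l1_norm_on b UNIV + t * l)"
      unfolding square by linarith
    then have "0 \<le> t * ((r \<bullet> z / N + g * l) + t * ((norm z)\<^sup>2 / (2 * N)))"
      by (simp add: algebra_simps power2_eq_square add_divide_distrib)
    then show ?thesis using t by (simp add: zero_le_mult_iff)
  qed
  then have "0 \<le> r \<bullet> z / N + g * l"
    by (rule nonneg_if_small_perturbations_nonneg)
  moreover have "(X *v b - y) \<bullet> z = - (r \<bullet> z)" by (simp add: r_def inner_diff_left)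
  ultimately show ?thesis by (simp add: N_def z_def l_def)
qed

lemma noise_inner_le:
  fixes X :: "real^'p^'n"
  assumes "infnorm ((1 / real CARD('n)) *\<^sub>R (transpose X *v e)) \<le> c"
  shows "\<bar>e \<bullet> (X *v h)\<bar> / real CARD('n) \<le> c * l1_norm_on h UNIV"
proof -
  let ?w = "(1 / real CARD('n)) *\<^sub>R (transpose X *v e)"
  have "e \<bullet> (X *v h) / real CARD('n) = ?w \<bullet> h"
    by (simp add: dot_lmul_matrix[symmetric] vector_transpose_matrix inner_commute)
  also have "\<bar>?w \<bullet> h\<bar> \<le> (\<Sum>j\<in>UNIV. \<bar>?w $ j * h $ j\<bar>)"
    unfolding inner_vec_def by (simp only: inner_real_def) (rule sum_abs)
  also have "\<dots> \<le> (\<Sum>j\<in>UNIV. c * \<bar>h $ j\<bar>)"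
  proof (rule sum_mono)
    fix j
    have "\<bar>?w $ j\<bar> \<le> c" using component_le_infnorm_cart[of ?w j] assms by linarith
    then show "\<bar>?w $ j * h $ j\<bar> \<le> c * \<bar>h $ j\<bar>" by (simp only: abs_mult) (rule mult_right_mono, auto)
  qed
  finally show ?thesis by (simp add: l1_norm_on_def sum_distrib_left)
qed

text \<open>
  With \<open>W = norm (X (b - \<beta>)) / sqrt n\<close> and \<open>V = norm (X h) / sqrt n\<close>, the variational inequality
  becomes a bound for \<open>W\<^sup>2 + V\<^sup>2\<close> by polarization. Noise at level \<open>g / 2\<close> costs half of the
  penalty of \<open>h\<close>; the other half remains on the left off \<open>T\<close>, where \<open>h\<close> agrees with \<open>b\<close>.
\<close>

lemma lasso_basic_inequality:
  fixes X :: "real^'p^'n"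
  assumes sol: "lasso_solution X (X *v \<beta> + e) g b" and g: "0 \<le> g"
    and noise: "infnorm ((1 / real CARD('n)) *\<^sub>R (transpose X *v e)) \<le> g / 2"
    and h: "h = b - zero_off T \<beta>"
  shows "(norm (X *v b - X *v \<beta>) / sqrt (real CARD('n)))\<^sup>2
      + (norm (X *v h) / sqrt (real CARD('n)))\<^sup>2 + g * l1_norm_on h (-T)
    \<le> (norm (X *v zero_off (-T) \<beta>) / sqrt (real CARD('n)))\<^sup>2 + 3 * g * l1_norm_on h T"
proof -
  define N where "N = real CARD('n)"
  have N: "0 < N" by (simp add: N_def)
  define w where "w = X *v b - X *v \<beta>"
  define z where "z = X *v h"
  have "w - z = - (X *v zero_off (-T) \<beta>)"
    using arg_cong[OF zero_off_Compl[of T \<beta>], of "(*v) X"]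
    by (simp add: w_def z_def h matrix_vector_mult_diff_distrib matrix_vector_right_distrib algebra_simps)
  then have A: "norm (X *v zero_off (-T) \<beta>) = norm (w - z)" by simp
  have pol: "2 * (w \<bullet> z) = (norm w)\<^sup>2 + (norm z)\<^sup>2 - (norm (w - z))\<^sup>2"
    unfolding power2_norm_eq_inner by (simp add: inner_simps inner_commute)
  have "(w - e) \<bullet> z / N \<le> g * (l1_norm_on (zero_off T \<beta>) UNIV - l1_norm_on b UNIV)"
    using lasso_variational_inequality[OF sol g, of "zero_off T \<beta>"]
    by (simp add: w_def z_def h N_def algebra_simps)
  moreover have "e \<bullet> z / N \<le> g / 2 * l1_norm_on h UNIV"
    using noise_inner_le[OF noise, of h] N
    by (simp add: N_def z_def abs_le_iff divide_le_eq)
  ultimately have "w \<bullet> z / N \<le> g * (l1_norm_on (zero_off T \<beta>) UNIV - l1_norm_on b UNIV)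
      + g / 2 * l1_norm_on h UNIV"
    by (simp add: inner_diff_left diff_divide_distrib)
  also have "\<dots> = g / 2 * (2 * l1_norm_on (zero_off T \<beta>) UNIV - 2 * l1_norm_on b UNIV + l1_norm_on h UNIV)"
    by (simp add: algebra_simps)
  also have "\<dots> \<le> g / 2 * (3 * l1_norm_on h T - l1_norm_on h (-T))"
  proof (rule mult_left_mono)
    have split: "l1_norm_on v UNIV = l1_norm_on v T + l1_norm_on v (-T)" for v :: "real^'p"
      using sum.subset_diff[of T UNIV "\<lambda>j. \<bar>v $ j\<bar>"]
      by (simp add: l1_norm_on_def Compl_eq_Diff_UNIV)
    have "l1_norm_on (zero_off T \<beta>) T \<le> l1_norm_on b T + l1_norm_on h T"
      unfolding l1_norm_on_def sum.distrib[symmetric]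
      by (rule sum_mono) (auto simp: h zero_off_def)
    moreover have "l1_norm_on (zero_off T \<beta>) (-T) = 0" "l1_norm_on h (-T) = l1_norm_on b (-T)"
      by (auto simp: l1_norm_on_def h zero_off_def)
    ultimately show "2 * l1_norm_on (zero_off T \<beta>) UNIV - 2 * l1_norm_on b UNIV + l1_norm_on h UNIV
        \<le> 3 * l1_norm_on h T - l1_norm_on h (-T)"
      by (simp add: split)
  qed (use g in simp)
  finally have "2 * (w \<bullet> z) / N \<le> g * (3 * l1_norm_on h T - l1_norm_on h (-T))"
    by (simp add: mult.commute)
  then show ?thesis
    unfolding pol A power_divide w_def[symmetric] z_def[symmetric]
    by (simp add: N_def[symmetric] N less_imp_le algebra_simps add_divide_distrib diff_divide_distrib)
qed

section \<open>The three regimes of the error\<close>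

text \<open>
  The next lemmas are the arithmetic of the basic inequality, with \<open>x\<close> and \<open>y\<close> for the penalty
  of \<open>h\<close> on and off \<open>T\<^sub>0\<close>. If \<open>y \<le> 3 x\<close>, the restricted eigenvalue gives \<open>x \<le> c3 * V\<close>
  and a square is completed. If \<open>3 x < y \<le> 4 x\<close>, then \<open>x \<le> c4 * V\<close> and \<open>V \<le> A\<close>; here \<open>V\<close>
  is compared with \<open>c4\<close>. If \<open>4 x < y\<close>, the penalty is dominated by \<open>A\<^sup>2\<close>, and
  \<open>A \<le> V + W\<close> saves a factor two.
\<close>

lemma half_square_le:
  fixes A V W :: real
  assumes "A \<le> V + W" "0 \<le> A"
  shows "A\<^sup>2 \<le> 2 * (W\<^sup>2 + V\<^sup>2)"
proof -
  have "A\<^sup>2 \<le> (V + W)\<^sup>2" using assms by (intro power_mono)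
  also have "\<dots> \<le> 2 * (W\<^sup>2 + V\<^sup>2)"
    using zero_le_power2[of "V - W"] by (simp add: power2_sum power2_diff)
  finally show ?thesis .
qed

lemma prediction_error_arith:
  fixes A V W x y c3 :: real
  assumes basic: "W\<^sup>2 + V\<^sup>2 + y \<le> A\<^sup>2 + 3 * x"
    and cone: "y \<le> 3 * x \<Longrightarrow> x \<le> c3 * V"
    and nonneg: "0 \<le> A" "0 \<le> y" "0 \<le> c3"
  shows "W \<le> A + 3 / 2 * c3"
proof -
  have "W\<^sup>2 \<le> A\<^sup>2 + (3 / 2 * c3)\<^sup>2"
  proof (cases "y \<le> 3 * x")
    case True
    then show ?thesis
      using basic cone nonneg zero_le_power2[of "V - 3 / 2 * c3"]
      by (simp add: power2_diff mult.commute)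
  next
    case False
    then show ?thesis using basic zero_le_power2[of V] zero_le_power2[of "3 / 2 * c3"] by linarith
  qed
  also have "\<dots> \<le> (A + 3 / 2 * c3)\<^sup>2"
    using nonneg by (simp add: power2_sum)
  finally show ?thesis by (rule power2_le_imp_le) (use nonneg in simp)
qed

lemma middle_regime:
  fixes A V W x y c4 :: real
  assumes basic: "W\<^sup>2 + V\<^sup>2 + y \<le> A\<^sup>2 + 3 * x" and "3 * x \<le> y" "x \<le> c4 * V"
    and nonneg: "0 \<le> A" "0 \<le> V"
  shows "V \<le> A" and "V \<le> c4 \<Longrightarrow> x \<le> c4\<^sup>2" and "c4 < V \<Longrightarrow> x \<le> V\<^sup>2"
proof -
  have "V\<^sup>2 \<le> A\<^sup>2" using basic assms(2) zero_le_power2[of W] by linarith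
  then show "V \<le> A" using nonneg by (rule_tac power2_le_imp_le)
  show "x \<le> c4\<^sup>2" if "V \<le> c4"
    using that assms(3) nonneg mult_left_mono[of V c4 c4] by (simp add: power2_eq_square)
  show "x \<le> V\<^sup>2" if "c4 < V"
    using that assms(3) nonneg mult_right_mono[of c4 V V] by (simp add: power2_eq_square)
qed

lemma far_regime:
  fixes x y w \<alpha> :: real
  assumes "4 * x < y" and "w + y \<le> \<alpha> + 3 * x" and "\<alpha> \<le> 2 * w"
  shows "y \<le> 2 * \<alpha>"
  using assms by linarith

lemma penalty_arith:
  fixes A V W x y c3 c4 Z :: real
  assumes basic: "W\<^sup>2 + V\<^sup>2 + y \<le> A\<^sup>2 + 3 * x"
    and cone3: "y \<le> 3 * x \<Longrightarrow> x \<le> c3 * V" and cone4: "y \<le> 4 * x \<Longrightarrow> x \<le> c4 * V"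
    and tri: "A \<le> V + W" and nonneg: "0 \<le> A" "0 \<le> V" "0 \<le> x" "0 \<le> y"
    and Z: "A\<^sup>2 + 4 * c3\<^sup>2 \<le> Z" "5 * c4\<^sup>2 \<le> Z" "4 * A\<^sup>2 \<le> Z"
  shows "x + y \<le> Z"
proof -
  consider "y \<le> 3 * x" | "3 * x < y" "y \<le> 4 * x" | "4 * x < y" by linarith
  then show ?thesis
  proof cases
    case 1
    then have "x + y \<le> A\<^sup>2 + 4 * (c3 * V) - V\<^sup>2" using basic cone3 zero_le_power2[of W] by linarith
    also have "\<dots> \<le> A\<^sup>2 + 4 * c3\<^sup>2"
      using zero_le_power2[of "V - 2 * c3"] by (simp add: power2_diff mult.commute)
    finally show ?thesis using Z by linarith
  next
    case 2
    note mid = middle_regime[OF basic less_imp_le[OF 2(1)] cone4[OF 2(2)] nonneg(1,2)]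
    have "V\<^sup>2 \<le> A\<^sup>2" using mid(1) nonneg by (intro power_mono)
    then show ?thesis
      using mid(2,3) 2 basic Z zero_le_power2[of W] by (cases "V \<le> c4") linarith+
  next
    case 3
    have "y \<le> 2 * A\<^sup>2" by (rule far_regime[OF 3 basic half_square_le[OF tri nonneg(1)]])
    then show ?thesis using 3 Z nonneg zero_le_power2[of A] by linarith
  qed
qed

lemma off_support_penalty_arith:
  fixes A V W x y c3 c4 Z :: real
  assumes basic: "W\<^sup>2 + V\<^sup>2 + y \<le> A\<^sup>2 + 3 * x"
    and cone3: "y \<le> 3 * x \<Longrightarrow> x \<le> c3 * V" and cone4: "y \<le> 4 * x \<Longrightarrow> x \<le> c4 * V"
    and tri: "A \<le> V + W" and nonneg: "0 \<le> A" "0 \<le> V" "0 \<le> x" "0 \<le> y"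
    and Z: "A\<^sup>2 + 9 / 4 * c3\<^sup>2 \<le> Z" "4 * c4\<^sup>2 \<le> Z" "3 * A\<^sup>2 \<le> Z"
  shows "y \<le> Z"
proof -
  consider "y \<le> 3 * x" | "3 * x < y" "y \<le> 4 * x" | "4 * x < y" by linarith
  then show ?thesis
  proof cases
    case 1
    then have "y \<le> A\<^sup>2 + 3 * (c3 * V) - V\<^sup>2" using basic cone3 zero_le_power2[of W] by linarith
    also have "\<dots> \<le> A\<^sup>2 + 9 / 4 * c3\<^sup>2"
      using zero_le_power2[of "V - 3 / 2 * c3"] by (simp add: power2_diff power_divide power_mult_distrib mult.commute)
    finally show ?thesis using Z by linarith
  next
    case 2
    note mid = middle_regime[OF basic less_imp_le[OF 2(1)] cone4[OF 2(2)] nonneg(1,2)]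
    have "V\<^sup>2 \<le> A\<^sup>2" using mid(1) nonneg by (intro power_mono)
    then show ?thesis
      using mid(2,3) 2 basic Z zero_le_power2[of W] by (cases "V \<le> c4") linarith+
  next
    case 3
    have "y \<le> 2 * A\<^sup>2" by (rule far_regime[OF 3 basic half_square_le[OF tri nonneg(1)]])
    then show ?thesis using 3 Z nonneg zero_le_power2[of A] by linarith
  qed
qed

lemma prediction_regimes:
  fixes A V W x y c3 c4 :: real
  assumes basic: "W\<^sup>2 + V\<^sup>2 + y \<le> A\<^sup>2 + 3 * x"
    and cone3: "y \<le> 3 * x \<Longrightarrow> x \<le> c3 * V" and cone4: "y \<le> 4 * x \<Longrightarrow> x \<le> c4 * V"
    and tri: "A \<le> V + W" "V \<le> A + W" and nonneg: "0 \<le> A" "0 \<le> V" "0 \<le> x" "0 \<le> y" "0 \<le> c3"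
  shows "(y \<le> 3 * x \<and> V \<le> A + 3 / 2 * c3) \<or> (y \<le> 4 * x \<and> V \<le> c4) \<or> (V \<le> A \<and> y \<le> 3 * A\<^sup>2)"
proof -
  consider "y \<le> 3 * x" | "3 * x < y" "y \<le> 4 * x" | "4 * x < y" by linarith
  then show ?thesis
  proof cases
    case 1
    have "V \<le> A + 3 / 2 * c3"
    proof (cases "V \<le> A")
      case False
      have "(V - A)\<^sup>2 \<le> W\<^sup>2" using tri False by (intro power_mono) auto
      then have "(V - A)\<^sup>2 + V\<^sup>2 \<le> A\<^sup>2 + 3 * (c3 * V)"
        using basic cone3[OF 1] nonneg by linarith
      then have "V * V \<le> V * (A + 3 / 2 * c3)"
        by (simp add: power2_diff power2_eq_square algebra_simps)
      then show ?thesis using False nonneg by (simp add: mult_le_cancel_left)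
    qed (use nonneg in simp)
    then show ?thesis using 1 by simp
  next
    case 2
    note mid = middle_regime[OF basic less_imp_le[OF 2(1)] cone4[OF 2(2)] nonneg(1,2)]
    show ?thesis
    proof (cases "V \<le> c4")
      case False
      have "V\<^sup>2 \<le> A\<^sup>2" using mid(1) nonneg by (intro power_mono)
      then have "y \<le> 3 * A\<^sup>2" using mid(3) False basic zero_le_power2[of W] by linarith
      then show ?thesis using mid(1) by simp
    qed (use 2 in simp)
  next
    case 3
    have "V\<^sup>2 \<le> A\<^sup>2" using 3 basic nonneg zero_le_power2[of W] by linarith
    then have "V \<le> A" using nonneg by (rule_tac power2_le_imp_le)
    moreover have "y \<le> 2 * A\<^sup>2" by (rule far_regime[OF 3 basic half_square_le[OF tri(1) nonneg(1)]])
    then have "y \<le> 3 * A\<^sup>2" using zero_le_power2[of A] by linarith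
    ultimately show ?thesis by simp
  qed
qed

section \<open>Splitting the error vector\<close>

lemma norm_tail_le:
  fixes h :: "real^'p"
  assumes m: "0 < m" and T1: "T1 \<subseteq> -T" "card T1 = min m (card (-T))"
    and largest: "\<forall>i\<in>T1. \<forall>j\<in>-T - T1. \<bar>h $ j\<bar> \<le> \<bar>h $ i\<bar>"
  shows "L2_set (($) h) (-(T \<union> T1)) \<le> l1_norm_on h (-T) / sqrt (real m)"
proof -
  have "L2_set (($) h) (-T - T1) \<le> 1 * ((\<Sum>j\<in>-T. \<bar>h $ j\<bar>) / sqrt (real m))"
  proof (rule greedy_tail_bound[where \<Omega> = UNIV, OF m])
    show "L2_set (($) h) (B \<union> C) \<le> L2_set (($) h) B + L2_set (($) h) C" if "B \<inter> C = {}" for B C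
      unfolding norm_zero_off[symmetric] zero_off_Un_disjoint[OF that] by (rule norm_triangle_ineq)
  qed (use T1 largest in auto)
  moreover have "-T - T1 = -(T \<union> T1)" by auto
  ultimately show ?thesis by (simp add: l1_norm_on_def)
qed

text \<open>
  The head is controlled through the \<open>2 m\<close>-sparse eigenvalue, up to the influence of the tail on
  the image of the head. The tail can enter through the norm of its image, or through the inner
  product of its image with that of the head; the minimum in \<^const>\<open>ell\<close> is over these two options.
\<close>

lemma norm_head_le:
  fixes X :: "real^'p^'n" and h :: "real^'p"
  assumes p: "2 \<le> CARD('p)" and m: "0 < m" and T: "card T \<le> m" and T1: "T1 \<subseteq> -T" "card T1 = min m (card (-T))"
    and largest: "\<forall>i\<in>T1. \<forall>j\<in>-T - T1. \<bar>h $ j\<bar> \<le> \<bar>h $ i\<bar>"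
    and pos: "0 < Lambda_min X (2 * m)"
  shows "sqrt (Lambda_min X (2 * m)) * L2_set (($) h) (T \<union> T1)
    \<le> norm (X *v h) / sqrt (real CARD('n)) + ell X m * (l1_norm_on h (-T) / sqrt (real m))"
proof -
  define N where "N = real CARD('n)"
  have N: "0 < N" by (simp add: N_def)
  define \<mu> where "\<mu> = sqrt (Lambda_min X (2 * m))"
  have \<mu>: "0 < \<mu>" using pos by (simp add: \<mu>_def)
  define U where "U = T \<union> T1"
  define H where "H = L2_set (($) h) U"
  define t where "t = l1_norm_on h (-T) / sqrt (real m)"
  have t: "0 \<le> t" by (simp add: t_def l1_norm_on_def sum_nonneg)
  define q where "q = X *v zero_off U h"
  define w where "w = X *v zero_off (-U) h"
  define V where "V = norm (X *v h) / sqrt N"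
  have qw: "X *v h = q + w"
    using zero_off_Compl[of U h] by (metis q_def w_def matrix_vector_right_distrib)
  have cardU: "card U \<le> 2 * m"
    unfolding U_def using card_Un_le[of T T1] T T1(2) by linarith
  have H_le: "\<mu> * H \<le> norm q / sqrt N"
    using Lambda_min_le_norm_matrix_mult[OF sparse_zero_off[OF cardU], of X h]
    by (simp add: \<mu>_def H_def q_def N_def norm_zero_off)
  have tail_eq: "-T - T1 = -U" by (auto simp: U_def)

  have "norm (X *v zero_off (-T - T1) h) / sqrt N
      \<le> sqrt (Lambda_max X m) * ((\<Sum>j\<in>-T. \<bar>h $ j\<bar>) / sqrt (real m))"
  proof (rule greedy_tail_bound[where \<Omega> = UNIV, OF m])
    show "norm (X *v zero_off (B \<union> C) h) / sqrt N
        \<le> norm (X *v zero_off B h) / sqrt N + norm (X *v zero_off C h) / sqrt N"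
      if "B \<inter> C = {}" for B C
      unfolding zero_off_Un_disjoint[OF that] matrix_vector_right_distrib add_divide_distrib[symmetric]
      using N by (intro divide_right_mono norm_triangle_ineq) auto
    show "norm (X *v zero_off B h) / sqrt N \<le> sqrt (Lambda_max X m) * L2_set (($) h) B"
      if "card B \<le> m" for B
      using norm_matrix_mult_le_Lambda_max[OF sparse_zero_off[OF that], of X h]
      by (simp add: norm_zero_off N_def)
  qed (use T1 largest Lambda_max_nonneg[of X m] in auto)
  then have w_le: "norm w / sqrt N \<le> sqrt (Lambda_max X m) * t"
    by (simp add: tail_eq w_def t_def l1_norm_on_def)
  have "norm q \<le> norm (X *v h) + norm w"
    using norm_triangle_ineq4[of "q + w" w] by (simp add: qw)
  then have "norm q / sqrt N \<le> V + norm w / sqrt N"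
    using N by (simp add: V_def divide_right_mono flip: add_divide_distrib)
  then have option1: "\<mu> * H \<le> V + sqrt (Lambda_max X m) * t"
    using H_le w_le by linarith

  let ?\<theta> = "restricted_orth X m (2 * m)"
  have "\<bar>submatrix_mult X (-T - T1) h \<bullet> submatrix_mult X U h\<bar> / N
      \<le> (?\<theta> * H) * ((\<Sum>j\<in>-T. \<bar>h $ j\<bar>) / sqrt (real m))"
  proof (rule greedy_tail_bound[where \<Omega> = "-U", OF m])
    show "0 \<le> ?\<theta> * H"
      using restricted_orth_nonneg[OF p m, of "2 * m" X] m by (simp add: H_def)
    show "\<bar>submatrix_mult X (B \<union> C) h \<bullet> submatrix_mult X U h\<bar> / N
        \<le> \<bar>submatrix_mult X B h \<bullet> submatrix_mult X U h\<bar> / N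
          + \<bar>submatrix_mult X C h \<bullet> submatrix_mult X U h\<bar> / N"
      if "B \<inter> C = {}" for B C
      unfolding submatrix_mult_eq zero_off_Un_disjoint[OF that] matrix_vector_right_distrib
        inner_add_left add_divide_distrib[symmetric]
      using N by (intro divide_right_mono abs_triangle_ineq) auto
    show "\<bar>submatrix_mult X B h \<bullet> submatrix_mult X U h\<bar> / N \<le> ?\<theta> * H * L2_set (($) h) B"
      if "B \<subseteq> -U" "card B \<le> m" for B
    proof -
      have "B \<inter> U = {}" using that(1) by blast
      from restricted_orth_le[OF this that(2) cardU, of X h h] show ?thesis
        by (simp only: H_def N_def mult_ac)
    qed
    show "-T - T1 \<subseteq> -U" by (simp only: tail_eq order.refl)
  qed (use T1 largest in simp_all)
  then have inner: "\<bar>w \<bullet> q\<bar> / N \<le> ?\<theta> * H * t"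
    by (simp add: tail_eq w_def q_def t_def l1_norm_on_def submatrix_mult_eq)
  have "- (w \<bullet> q) / N \<le> \<bar>w \<bullet> q\<bar> / N" using N by (intro divide_right_mono) auto
  with inner have cross: "- (w \<bullet> q) / N \<le> ?\<theta> * t * H" by (simp only: mult_ac)
  have option2: "\<mu> * H \<le> V + ?\<theta> / \<mu> * t"
  proof -
    define Q where "Q = norm q / sqrt N"
    have \<theta>t: "0 \<le> ?\<theta> * t" using restricted_orth_nonneg[OF p m, of "2 * m" X] m t by simp
    have V: "0 \<le> V" using N by (simp add: V_def)
    have "Q\<^sup>2 = (q \<bullet> q) / N" using N by (simp add: Q_def power_divide power2_norm_eq_inner)
    also have "\<dots> = (X *v h) \<bullet> q / N + - (w \<bullet> q) / N"
      by (simp add: qw inner_add_left add_divide_distrib)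
    also have "(X *v h) \<bullet> q / N \<le> V * Q"
      using norm_cauchy_schwarz[of "X *v h" q] N
      by (simp add: V_def Q_def divide_right_mono)
    also have "- (w \<bullet> q) / N \<le> ?\<theta> * t * H" by (rule cross)
    also have "?\<theta> * t * H \<le> ?\<theta> * t * (Q / \<mu>)"
    proof (rule mult_left_mono[OF _ \<theta>t])
      have "H * \<mu> \<le> Q" using H_le by (simp only: Q_def mult.commute)
      then show "H \<le> Q / \<mu>" by (subst pos_le_divide_eq[OF \<mu>])
    qed
    also have "V * Q + ?\<theta> * t * (Q / \<mu>) = (V + ?\<theta> / \<mu> * t) * Q"
      by (simp add: algebra_simps)
    finally have "Q * Q \<le> (V + ?\<theta> / \<mu> * t) * Q"
      by (simp add: power2_eq_square)
    then have "Q \<le> V + ?\<theta> / \<mu> * t" if "0 < Q"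
      using that by (rule mult_right_le_imp_le)
    moreover have "0 \<le> ?\<theta> * t / \<mu>" using \<theta>t \<mu> by (intro divide_nonneg_pos)
    ultimately have "Q \<le> V + ?\<theta> / \<mu> * t"
      using V by (cases "0 < Q") auto
    then show ?thesis using H_le unfolding Q_def by linarith
  qed
  have "ell X m = ?\<theta> / \<mu> \<or> ell X m = sqrt (Lambda_max X m)"
    by (simp add: ell_def \<mu>_def min_def)
  then have "\<mu> * H \<le> V + ell X m * t"
    by (rule disjE) (simp_all only: option1 option2)
  then show ?thesis by (simp only: \<mu>_def H_def U_def V_def t_def N_def)
qed

section \<open>Error bounds for the Lasso\<close>

lemma RE_cone_three:
  fixes X :: "real^'p^'n"
  assumes "RE m 4 X"
  shows "0 < RE_min X m 3" and "RE_K X m 3 \<le> RE_K X m 4" and "0 \<le> RE_K X m 3"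
proof -
  have "RE_min X m 4 \<le> RE_min X m 3" using assms by (intro RE_min_antimono) (auto simp: RE_def)
  moreover have "0 < RE_min X m 4" using assms by (simp add: RE_def)
  ultimately show "0 < RE_min X m 3" "RE_K X m 3 \<le> RE_K X m 4" "0 \<le> RE_K X m 3"
    by (auto simp: RE_K_def frac_le)
qed

lemma l1_le_in_cone:
  fixes X :: "real^'p^'n"
  assumes "0 < RE_min X m k0" "card T \<le> m" "l1_norm_on h (-T) \<le> k0 * l1_norm_on h T"
  shows "l1_norm_on h T \<le> sqrt (real m) * RE_K X m k0 * (norm (X *v h) / sqrt (real CARD('n)))"
proof -
  have "l1_norm_on h T \<le> sqrt (real m) * L2_set (($) h) T"
    unfolding l1_norm_on_def by (rule l1_le_sqrt_card_L2[OF assms(2)])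
  also have "\<dots> \<le> sqrt (real m) * (RE_K X m k0 * (norm (X *v h) / sqrt (real CARD('n))))"
    by (intro mult_left_mono RE_min_bound[OF assms]) auto
  finally show ?thesis by (simp only: mult.assoc)
qed

lemma lasso_prediction_error:
  fixes X :: "real^'p^'n"
  assumes re: "RE (card T) 4 X"
    and sol: "lasso_solution X (X *v \<beta> + e) g b" and g: "0 < g"
    and noise: "infnorm ((1 / real CARD('n)) *\<^sub>R (transpose X *v e)) \<le> g / 2"
  shows "norm (X *v b - X *v \<beta>) / sqrt (real CARD('n))
    \<le> norm (X *v zero_off (-T) \<beta>) / sqrt (real CARD('n))
        + 3 / 2 * RE_K X (card T) 3 * g * sqrt (real (card T))"
proof -
  define h where "h = b - zero_off T \<beta>"
  let ?c = "g * (sqrt (real (card T)) * RE_K X (card T) 3)"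
  note re3 = RE_cone_three[OF re]
  have "norm (X *v b - X *v \<beta>) / sqrt (real CARD('n))
      \<le> norm (X *v zero_off (-T) \<beta>) / sqrt (real CARD('n)) + 3 / 2 * ?c"
  proof (rule prediction_error_arith)
    show "(norm (X *v b - X *v \<beta>) / sqrt (real CARD('n)))\<^sup>2
        + (norm (X *v h) / sqrt (real CARD('n)))\<^sup>2 + g * l1_norm_on h (-T)
      \<le> (norm (X *v zero_off (-T) \<beta>) / sqrt (real CARD('n)))\<^sup>2 + 3 * (g * l1_norm_on h T)"
      using lasso_basic_inequality[OF sol less_imp_le[OF g] noise h_def] by (simp only: mult.assoc)
    assume "g * l1_norm_on h (-T) \<le> 3 * (g * l1_norm_on h T)"
    then have "g * l1_norm_on h (-T) \<le> g * (3 * l1_norm_on h T)" by simp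
    then have "l1_norm_on h (-T) \<le> 3 * l1_norm_on h T" using g by (rule mult_left_le_imp_le)
    from l1_le_in_cone[OF re3(1) order.refl this]
    have "g * l1_norm_on h T \<le> g * (sqrt (real (card T)) * RE_K X (card T) 3
        * (norm (X *v h) / sqrt (real CARD('n))))"
      using g by (intro mult_left_mono) auto
    then show "g * l1_norm_on h T \<le> ?c * (norm (X *v h) / sqrt (real CARD('n)))"
      by (simp only: mult.assoc)
  qed (use g re3 in \<open>auto simp: l1_norm_on_def sum_nonneg\<close>)
  then show ?thesis by (simp only: mult_ac)
qed

text \<open>
  The scale of all errors is \<open>u = P * sqrt m\<close>, where \<open>P\<close> is \<open>\<lambda> \<sigma>\<close> and \<open>m\<close> is the essential
  sparsity. Off \<open>T\<close> the target contributes at most \<open>sqrt (Lambda_max X (s - m)) * u\<close> to the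
  prediction, and the restricted eigenvalues enter the regimes through \<open>d0 * u * RE_K X m k\<close>.
\<close>

lemma lasso_error_bounds:
  fixes X :: "real^'p^'n" and \<beta> b h :: "real^'p"
  assumes p: "2 \<le> CARD('p)" and re: "RE m 4 X" and T: "card T = m"
    and P: "0 < P" and d0: "0 < d0"
    and sol: "lasso_solution X (X *v \<beta> + e) (d0 * P) b"
    and noise: "infnorm ((1 / real CARD('n)) *\<^sub>R (transpose X *v e)) \<le> d0 * P / 2"
    and h: "h = b - zero_off T \<beta>"
    and off: "norm (X *v zero_off (-T) \<beta>) / sqrt (real CARD('n))
        \<le> sqrt (Lambda_max X (s - m)) * (P * sqrt (real m))"
  shows "norm h \<le> P * sqrt (real m) * sqrt ((const_D0 X s m d0)\<^sup>2 + (const_D1 X s m d0)\<^sup>2)"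
    and "l1_norm_on h T + l1_norm_on h (-T) \<le> const_D2 X s m d0 * P * real m"
proof -
  define \<Lambda> where "\<Lambda> = Lambda_max X (s - m)"
  define L where "L = sqrt \<Lambda>"
  define u where "u = P * sqrt (real m)"
  define K3 where "K3 = RE_K X m 3"
  define K4 where "K4 = RE_K X m 4"
  define A where "A = norm (X *v zero_off (-T) \<beta>) / sqrt (real CARD('n))"
  define W where "W = norm (X *v b - X *v \<beta>) / sqrt (real CARD('n))"
  define V where "V = norm (X *v h) / sqrt (real CARD('n))"
  define x where "x = d0 * P * l1_norm_on h T"
  define y where "y = d0 * P * l1_norm_on h (-T)"
  have m: "0 < m" "m \<le> CARD('p)" and re4: "0 < RE_min X m 4" using re by (auto simp: RE_def)
  note re3 = RE_cone_three[OF re]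
  have K: "0 \<le> K3" "K3 \<le> K4" using re3 by (auto simp: K3_def K4_def)
  have g: "0 < d0 * P" using P d0 by simp
  have u: "0 < u" using P m by (simp add: u_def)
  have L: "0 \<le> L" "L\<^sup>2 = \<Lambda>" using Lambda_max_nonneg[of X "s - m"] by (auto simp: L_def \<Lambda>_def)
  have nonneg: "0 \<le> A" "0 \<le> V" "0 \<le> x" "0 \<le> y"
    using g by (auto simp: A_def V_def x_def y_def l1_norm_on_def sum_nonneg)

  have basic: "W\<^sup>2 + V\<^sup>2 + y \<le> A\<^sup>2 + 3 * x"
    using lasso_basic_inequality[OF sol less_imp_le[OF g] noise h]
    by (simp add: W_def V_def A_def x_def y_def)
  have cone: "l1_norm_on h (-T) \<le> k * l1_norm_on h T" if "y \<le> k * x" for k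
  proof -
    have "(d0 * P) * l1_norm_on h (-T) \<le> (d0 * P) * (k * l1_norm_on h T)"
      using that by (simp add: x_def y_def mult_ac)
    then show ?thesis using g by (rule mult_left_le_imp_le)
  qed
  have cone_x: "x \<le> d0 * u * RE_K X m k * V" if "y \<le> k * x" "0 < RE_min X m k" for k
  proof -
    have "x \<le> d0 * P * (sqrt (real m) * RE_K X m k * V)"
      unfolding x_def V_def using g T that(2) cone[OF that(1)]
      by (intro mult_left_mono l1_le_in_cone) auto
    then show ?thesis by (simp add: u_def mult_ac)
  qed
  have cone3: "x \<le> d0 * u * K3 * V" if "y \<le> 3 * x"
    unfolding K3_def using that re3(1) by (rule cone_x)
  have cone4: "x \<le> d0 * u * K4 * V" if "y \<le> 4 * x"
    unfolding K4_def using that re4 by (rule cone_x)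

  have "X *v h = (X *v b - X *v \<beta>) + X *v zero_off (-T) \<beta>"
    using arg_cong[OF zero_off_Compl[of T \<beta>], of "(*v) X"]
    by (simp add: h matrix_vector_mult_diff_distrib matrix_vector_right_distrib algebra_simps)
  then have "norm (X *v h) \<le> norm (X *v b - X *v \<beta>) + norm (X *v zero_off (-T) \<beta>)"
    and "norm (X *v zero_off (-T) \<beta>) \<le> norm (X *v h) + norm (X *v b - X *v \<beta>)"
    using norm_triangle_ineq norm_triangle_ineq4[of "X *v h" "X *v b - X *v \<beta>"] by simp_all
  then have tri: "A \<le> V + W" "V \<le> A + W"
    by (simp_all add: A_def V_def W_def add.commute divide_right_mono flip: add_divide_distrib)
  have A_le: "A \<le> L * u" using off by (simp add: A_def L_def u_def \<Lambda>_def)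
  have "A\<^sup>2 \<le> (L * u)\<^sup>2" using A_le nonneg(1) by (rule power_mono)
  then have A2: "A\<^sup>2 \<le> u\<^sup>2 * \<Lambda>" by (simp add: power_mult_distrib L(2) mult.commute)

  have l1_from_penalty: "z \<le> D * P * real m" if "d0 * P * z \<le> u\<^sup>2 * (d0 * D)" for z D
  proof -
    have "(d0 * P) * z \<le> (d0 * P) * (D * P * real m)"
      using that P by (simp add: u_def power_mult_distrib power2_eq_square mult_ac)
    then show ?thesis using g by (rule mult_left_le_imp_le)
  qed

  have D2: "\<Lambda> + 4 * (d0 * K3)\<^sup>2 \<le> d0 * const_D2 X s m d0"
    "5 * (d0 * K4)\<^sup>2 \<le> d0 * const_D2 X s m d0" "4 * \<Lambda> \<le> d0 * const_D2 X s m d0"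
  proof -
    have eqs: "\<Lambda> + 4 * (d0 * K3)\<^sup>2 = d0 * (d0 * (\<Lambda> / d0\<^sup>2 + 4 * K3\<^sup>2))"
      "5 * (d0 * K4)\<^sup>2 = d0 * (d0 * (5 * K4\<^sup>2))"
      "4 * \<Lambda> = d0 * (d0 * (4 * \<Lambda> / d0\<^sup>2))"
      using d0 by (simp_all add: power2_eq_square field_simps)
    show "\<Lambda> + 4 * (d0 * K3)\<^sup>2 \<le> d0 * const_D2 X s m d0"
      using d0 by (subst eqs(1), unfold const_D2_def, intro mult_left_mono)
        (auto simp: \<Lambda>_def K3_def K4_def)
    show "5 * (d0 * K4)\<^sup>2 \<le> d0 * const_D2 X s m d0"
      using d0 by (subst eqs(2), unfold const_D2_def, intro mult_left_mono)
        (auto simp: \<Lambda>_def K3_def K4_def)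
    show "4 * \<Lambda> \<le> d0 * const_D2 X s m d0"
      using d0 by (subst eqs(3), unfold const_D2_def, intro mult_left_mono)
        (auto simp: \<Lambda>_def K3_def K4_def)
  qed
  have "x + y \<le> u\<^sup>2 * (d0 * const_D2 X s m d0)"
  proof (rule penalty_arith[OF basic cone3 cone4 tri(1) nonneg])
    have "A\<^sup>2 + 4 * (d0 * u * K3)\<^sup>2 \<le> u\<^sup>2 * (\<Lambda> + 4 * (d0 * K3)\<^sup>2)"
      using A2 by (simp add: power_mult_distrib algebra_simps)
    also have "\<dots> \<le> u\<^sup>2 * (d0 * const_D2 X s m d0)" using D2(1) by (rule mult_left_mono) simp
    finally show "A\<^sup>2 + 4 * (d0 * u * K3)\<^sup>2 \<le> u\<^sup>2 * (d0 * const_D2 X s m d0)" .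
    have "5 * (d0 * u * K4)\<^sup>2 = u\<^sup>2 * (5 * (d0 * K4)\<^sup>2)" by (simp add: power_mult_distrib)
    also have "\<dots> \<le> u\<^sup>2 * (d0 * const_D2 X s m d0)" using D2(2) by (rule mult_left_mono) simp
    finally show "5 * (d0 * u * K4)\<^sup>2 \<le> u\<^sup>2 * (d0 * const_D2 X s m d0)" .
    have "4 * A\<^sup>2 \<le> u\<^sup>2 * (4 * \<Lambda>)" using A2 by simp
    also have "\<dots> \<le> u\<^sup>2 * (d0 * const_D2 X s m d0)" using D2(3) by (rule mult_left_mono) simp
    finally show "4 * A\<^sup>2 \<le> u\<^sup>2 * (d0 * const_D2 X s m d0)" .
  qed
  then show "l1_norm_on h T + l1_norm_on h (-T) \<le> const_D2 X s m d0 * P * real m"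
    by (intro l1_from_penalty) (simp add: x_def y_def distrib_left)

  have D1: "\<Lambda> + 9 / 4 * (d0 * K3)\<^sup>2 \<le> d0 * const_D1 X s m d0"
    "4 * (d0 * K4)\<^sup>2 \<le> d0 * const_D1 X s m d0" "3 * \<Lambda> \<le> d0 * const_D1 X s m d0"
  proof -
    have eqs: "\<Lambda> + 9 / 4 * (d0 * K3)\<^sup>2 = d0 * (d0 * (\<Lambda> / d0\<^sup>2 + 9 / 4 * K3\<^sup>2))"
      "4 * (d0 * K4)\<^sup>2 = d0 * (d0 * (4 * K4\<^sup>2))"
      "3 * \<Lambda> = d0 * (d0 * (3 * \<Lambda> / d0\<^sup>2))"
      using d0 by (simp_all add: power2_eq_square field_simps)
    show "\<Lambda> + 9 / 4 * (d0 * K3)\<^sup>2 \<le> d0 * const_D1 X s m d0"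
      using d0 by (subst eqs(1), unfold const_D1_def, intro mult_left_mono)
        (auto simp: \<Lambda>_def K3_def K4_def)
    show "4 * (d0 * K4)\<^sup>2 \<le> d0 * const_D1 X s m d0"
      using d0 by (subst eqs(2), unfold const_D1_def, intro mult_left_mono)
        (auto simp: \<Lambda>_def K3_def K4_def)
    show "3 * \<Lambda> \<le> d0 * const_D1 X s m d0"
      using d0 by (subst eqs(3), unfold const_D1_def, intro mult_left_mono)
        (auto simp: \<Lambda>_def K3_def K4_def)
  qed
  have "y \<le> u\<^sup>2 * (d0 * const_D1 X s m d0)"
  proof (rule off_support_penalty_arith[OF basic cone3 cone4 tri(1) nonneg])
    have "A\<^sup>2 + 9 / 4 * (d0 * u * K3)\<^sup>2 \<le> u\<^sup>2 * (\<Lambda> + 9 / 4 * (d0 * K3)\<^sup>2)"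
      using A2 by (simp add: power_mult_distrib algebra_simps)
    also have "\<dots> \<le> u\<^sup>2 * (d0 * const_D1 X s m d0)" using D1(1) by (rule mult_left_mono) simp
    finally show "A\<^sup>2 + 9 / 4 * (d0 * u * K3)\<^sup>2 \<le> u\<^sup>2 * (d0 * const_D1 X s m d0)" .
    have "4 * (d0 * u * K4)\<^sup>2 = u\<^sup>2 * (4 * (d0 * K4)\<^sup>2)" by (simp add: power_mult_distrib)
    also have "\<dots> \<le> u\<^sup>2 * (d0 * const_D1 X s m d0)" using D1(2) by (rule mult_left_mono) simp
    finally show "4 * (d0 * u * K4)\<^sup>2 \<le> u\<^sup>2 * (d0 * const_D1 X s m d0)" .
    have "3 * A\<^sup>2 \<le> u\<^sup>2 * (3 * \<Lambda>)" using A2 by simp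
    also have "\<dots> \<le> u\<^sup>2 * (d0 * const_D1 X s m d0)" using D1(3) by (rule mult_left_mono) simp
    finally show "3 * A\<^sup>2 \<le> u\<^sup>2 * (d0 * const_D1 X s m d0)" .
  qed
  then have l1_off: "l1_norm_on h (-T) \<le> const_D1 X s m d0 * P * real m"
    by (intro l1_from_penalty) (simp add: y_def)

  \<comment> \<open>Fewer than \<open>m\<close> indices may be left off \<open>T\<close>, since \<open>2 * m\<close> may exceed the dimension.\<close>
  obtain T1 where T1: "T1 \<subseteq> -T" "card T1 = min m (card (-T))"
      "\<forall>i\<in>T1. \<forall>j\<in>-T - T1. \<bar>h $ j\<bar> \<le> \<bar>h $ i\<bar>"
    using ex_largest_subset[of "-T" "min m (card (-T))" "\<lambda>j. \<bar>h $ j\<bar>"] by auto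
  have div_sqrt: "z * real m / sqrt (real m) = z * sqrt (real m)" for z
    by (simp add: real_div_sqrt flip: times_divide_eq_right)
  define H where "H = L2_set (($) h) (T \<union> T1)"
  have tail: "L2_set (($) h) (-(T \<union> T1)) \<le> u * const_D1 X s m d0"
  proof -
    have "L2_set (($) h) (-(T \<union> T1)) \<le> l1_norm_on h (-T) / sqrt (real m)"
      using m(1) T1 by (rule norm_tail_le)
    also have "\<dots> \<le> const_D1 X s m d0 * P * real m / sqrt (real m)"
      using l1_off by (rule divide_right_mono) simp
    also have "\<dots> = u * const_D1 X s m d0"
      by (simp only: div_sqrt) (simp add: u_def)
    finally show ?thesis .
  qed

  have H_cone: "H \<le> sqrt 2 * (RE_K X m k * V)" if yk: "y \<le> k * x" and pos: "0 < RE_min X m k" "0 \<le> k" for k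
  proof -
    have each: "L2_set (($) h) B \<le> RE_K X m k * V" if "card B \<le> m" for B
      unfolding V_def
      by (rule RE_min_bound_any_set[OF pos m(2) eq_refl[OF T] cone[OF yk] that])
    have "H\<^sup>2 = (L2_set (($) h) T)\<^sup>2 + (L2_set (($) h) T1)\<^sup>2"
      unfolding H_def using T1(1) by (intro L2_set_Un_power2) auto
    also have "\<dots> \<le> (RE_K X m k * V)\<^sup>2 + (RE_K X m k * V)\<^sup>2"
      using T T1(2) by (intro add_mono power_mono each) auto
    also have "\<dots> = (sqrt 2 * (RE_K X m k * V))\<^sup>2" by (simp add: power_mult_distrib)
    finally show ?thesis
      by (rule power2_le_imp_le) (use pos nonneg in \<open>simp add: RE_K_def\<close>)
  qed
  have head: "H \<le> u * const_D0 X s m d0"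
  proof -
    let ?R = "d0 * K4\<^sup>2 + K3 * L + 2 * d0 * K3\<^sup>2"
    have D0: "const_D X s m d0 \<le> const_D0 X s m d0" "sqrt 2 * ?R \<le> const_D0 X s m d0"
      by (simp_all add: const_D0_def K3_def K4_def L_def \<Lambda>_def)
    have in_cone: "H \<le> u * const_D0 X s m d0"
      if "H \<le> sqrt 2 * (c * V)" "c * V \<le> u * ?R" for c
    proof -
      have "sqrt 2 * (c * V) \<le> u * (sqrt 2 * ?R)"
        using mult_left_mono[OF that(2), of "sqrt 2"] by (simp add: mult_ac)
      also have "\<dots> \<le> u * const_D0 X s m d0" using D0(2) u by (intro mult_left_mono) auto
      finally show ?thesis using that(1) by linarith
    qed
    have summands: "0 \<le> d0 * K4\<^sup>2" "0 \<le> K3 * L" "0 \<le> d0 * K3\<^sup>2"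
      using d0 K L by auto
    from prediction_regimes[OF basic cone3 cone4 tri nonneg]
    consider "y \<le> 3 * x" "V \<le> A + 3 / 2 * (d0 * u * K3)" | "y \<le> 4 * x" "V \<le> d0 * u * K4"
      | "V \<le> A" "y \<le> 3 * A\<^sup>2"
      using d0 u K by auto
    then show ?thesis
    proof cases
      case 1
      have "K3 * V \<le> K3 * (L * u + 3 / 2 * (d0 * u * K3))"
        using 1(2) A_le K(1) by (intro mult_left_mono) auto
      also have "\<dots> = u * (K3 * L + 3 / 2 * (d0 * K3\<^sup>2))"
        by (simp add: algebra_simps power2_eq_square)
      also have "\<dots> \<le> u * ?R" using summands u by (intro mult_left_mono) auto
      finally show ?thesis using H_cone[OF 1(1) re3(1)] by (intro in_cone[of K3]) (auto simp: K3_def)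
    next
      case 2
      have "K4 * V \<le> K4 * (d0 * u * K4)" using 2(2) K by (intro mult_left_mono) auto
      also have "\<dots> = u * (d0 * K4\<^sup>2)" by (simp add: power2_eq_square)
      also have "\<dots> \<le> u * ?R" using summands u by (intro mult_left_mono) auto
      finally show ?thesis using H_cone[OF 2(1) re4] by (intro in_cone[of K4]) (auto simp: K4_def)
    next
      case 3
      \<comment> \<open>Here \<open>h\<close> may lie outside both cones; the sparse eigenvalue replaces the restricted ones.\<close>
      define \<mu> where "\<mu> = sqrt (Lambda_min X (2 * m))"
      have pos: "0 < Lambda_min X (2 * m)" using Lambda_min_pos[OF re4 _ m] by simp
      then have \<mu>: "0 < \<mu>" by (simp add: \<mu>_def)
      have ell: "0 \<le> ell X m"
        using restricted_orth_nonneg[OF p m(1), of "2 * m" X] m(1) \<mu> Lambda_max_nonneg[of X m]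
        by (simp add: ell_def \<mu>_def min_def)
      have "d0 * P * l1_norm_on h (-T) \<le> u\<^sup>2 * (d0 * (3 * \<Lambda> / d0))"
        using 3(2) A2 d0 by (simp add: y_def)
      then have "l1_norm_on h (-T) \<le> 3 * \<Lambda> / d0 * P * real m" by (rule l1_from_penalty)
      then have "l1_norm_on h (-T) / sqrt (real m) \<le> 3 * \<Lambda> / d0 * P * real m / sqrt (real m)"
        by (rule divide_right_mono) simp
      also have "\<dots> = 3 * L\<^sup>2 / d0 * u"
        by (simp only: div_sqrt) (simp add: L(2) u_def)
      finally have t_le: "l1_norm_on h (-T) / sqrt (real m) \<le> 3 * L\<^sup>2 / d0 * u" .
      have "\<mu> * H \<le> V + ell X m * (l1_norm_on h (-T) / sqrt (real m))"
        unfolding \<mu>_def H_def V_def using p m(1) eq_refl[OF T] T1 pos by (rule norm_head_le)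
      also have "\<dots> \<le> L * u + ell X m * (3 * L\<^sup>2 / d0 * u)"
        using 3(1) A_le t_le ell by (intro add_mono mult_left_mono) auto
      also have "\<dots> = u * (L * (1 + 3 * ell X m * L / d0))"
        by (simp add: algebra_simps power2_eq_square)
      also have "\<dots> = \<mu> * (u * const_D X s m d0)"
        using \<mu> by (simp add: const_D_def real_sqrt_divide L_def \<Lambda>_def \<mu>_def)
      finally have "H \<le> u * const_D X s m d0" using \<mu> by (rule mult_left_le_imp_le)
      also have "\<dots> \<le> u * const_D0 X s m d0" using D0(1) u by (intro mult_left_mono) auto
      finally show ?thesis .
    qed
  qed
  have "(norm h)\<^sup>2 = H\<^sup>2 + (L2_set (($) h) (-(T \<union> T1)))\<^sup>2"
    unfolding H_def by (rule norm_power2_split)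
  also have "\<dots> \<le> (u * const_D0 X s m d0)\<^sup>2 + (u * const_D1 X s m d0)\<^sup>2"
    using head tail by (intro add_mono power_mono) (auto simp: H_def)
  also have "\<dots> = u\<^sup>2 * ((const_D0 X s m d0)\<^sup>2 + (const_D1 X s m d0)\<^sup>2)"
    by (simp add: power_mult_distrib distrib_left)
  finally have "norm h \<le> sqrt (u\<^sup>2 * ((const_D0 X s m d0)\<^sup>2 + (const_D1 X s m d0)\<^sup>2))"
    by (rule real_le_rsqrt)
  then show "norm h \<le> P * sqrt (real m) * sqrt ((const_D0 X s m d0)\<^sup>2 + (const_D1 X s m d0)\<^sup>2)"
    using u by (simp add: real_sqrt_mult u_def)
qed


theorem theorem2p4:
  fixes M :: "'w measure"
    and \<epsilon> Y :: "'w \<Rightarrow> real^'n"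
    and X :: "real^'p^'n"
    and \<beta> :: "real^'p"
    and \<sigma> a d0 lam_n :: real
    and s s0 :: nat
    and S T0 :: "'p set"
  assumes "CARD('n) \<le> CARD('p)" and "2 \<le> CARD('p)"
    and "prob_space M"
    and "\<sigma> > 0"
    and "isotropic_gaussian M \<epsilon> \<sigma>"
    and "\<forall>\<omega>\<in>space M. Y \<omega> = X *v \<beta> + \<epsilon> \<omega>"
    and "\<forall>j. norm (column j X) = sqrt (real CARD('n))"
    and "S = supp \<beta>" and "s = card S"
    and "s0 = essential_sparsity X \<sigma> \<beta>"
    and "largest_positions \<beta> s0 T0"
    and "RE s0 4 X"
    and "bdd_above (sparse_quotients X (2 * s))"
    and "a \<ge> 0" and "d0 \<ge> 2 * sqrt (1 + a)"
    and "lam_n = d0 * lam X * \<sigma>"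
  shows "\<forall>\<omega>\<in>space M. \<epsilon> \<omega> \<in> noise_event X \<sigma> a \<longrightarrow>
    (\<forall>\<beta>_init h. lasso_solution X (Y \<omega>) lam_n \<beta>_init \<longrightarrow> h = \<beta>_init - zero_off T0 \<beta> \<longrightarrow>
       norm (\<beta>_init - \<beta>)
         \<le> lam X * \<sigma> * sqrt (real s0)
            * (sqrt ((const_D0 X s s0 d0)\<^sup>2 + (const_D1 X s s0 d0)\<^sup>2) + 1)
     \<and> l1_norm_on h T0 + l1_norm_on h (-T0)
         = l1_norm_on (\<beta> - \<beta>_init) T0 + l1_norm_on \<beta>_init (-T0)
     \<and> l1_norm_on (\<beta> - \<beta>_init) T0 + l1_norm_on \<beta>_init (-T0)
         \<le> const_D2 X s s0 d0 * lam X * \<sigma> * real s0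
     \<and> norm (X *v \<beta>_init - X *v \<beta>) / sqrt (real CARD('n))
         \<le> const_D3 X s s0 d0 * lam X * \<sigma> * sqrt (real s0)
     \<and> (\<forall>I0. I0 \<subseteq> S \<and> RE (card I0) 4 X \<longrightarrow>
          norm (X *v \<beta>_init - X *v \<beta>) / sqrt (real CARD('n))
            \<le> norm (X *v \<beta> - submatrix_mult X I0 \<beta>) / sqrt (real CARD('n))
               + 3 / 2 * RE_K X (card I0) 4 * lam_n * sqrt (real (card I0))))"
proof (intro ballI impI allI)
  fix \<omega> \<beta>_init h
  assume \<omega>: "\<omega> \<in> space M" "\<epsilon> \<omega> \<in> noise_event X \<sigma> a"
    and sol: "lasso_solution X (Y \<omega>) lam_n \<beta>_init"
    and h: "h = \<beta>_init - zero_off T0 \<beta>"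
  define P where "P = lam X * \<sigma>"
  define u where "u = P * sqrt (real s0)"
  define L where "L = sqrt (Lambda_max X (s - s0))"
  define W where "W = norm (X *v \<beta>_init - X *v \<beta>) / sqrt (real CARD('n))"
  have P: "0 < P" using lam_pos[of X] assms by (simp add: P_def)
  have d0: "0 < d0" using assms(14,15) by (smt (verit) real_sqrt_gt_0_iff)
  have lam_n: "lam_n = d0 * P" using assms by (simp add: P_def)
  have T0: "card T0 = s0" using assms by (simp add: largest_positions_def)
  have sol': "lasso_solution X (X *v \<beta> + \<epsilon> \<omega>) (d0 * P) \<beta>_init"
    using sol assms(6) \<omega>(1) by (simp add: lam_n)
  have noise: "infnorm ((1 / real CARD('n)) *\<^sub>R (transpose X *v \<epsilon> \<omega>)) \<le> d0 * P / 2"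
  proof -
    have "infnorm ((1 / real CARD('n)) *\<^sub>R (transpose X *v \<epsilon> \<omega>)) \<le> lam_noise X \<sigma> a"
      using \<omega>(2) by (simp add: noise_event_def)
    also have "\<dots> = sqrt (1 + a) * P" by (simp add: lam_noise_def P_def lam_def)
    also have "\<dots> \<le> d0 / 2 * P" using assms(15) P by (intro mult_right_mono) auto
    finally show ?thesis by simp
  qed
  have off: "norm (zero_off (-T0) \<beta>) \<le> u"
    using norm_off_largest_positions[of \<sigma> \<beta> X T0] assms(2,4,10,11)
    by (simp add: norm_zero_off u_def P_def)
  have "s0 \<le> s" using essential_sparsity_le_card_supp assms by simp
  then have "sparse (s - s0) (zero_off (-T0) \<beta>)"
    using sparse_off_largest_positions[OF assms(11)] assms by simp
  then have "norm (X *v zero_off (-T0) \<beta>) / sqrt (real CARD('n)) \<le> L * norm (zero_off (-T0) \<beta>)"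
    unfolding L_def by (rule norm_matrix_mult_le_Lambda_max)
  also have "\<dots> \<le> L * u"
    using off Lambda_max_nonneg[of X "s - s0"] by (intro mult_left_mono) (auto simp: L_def)
  finally have off_image: "norm (X *v zero_off (-T0) \<beta>) / sqrt (real CARD('n)) \<le> L * u" .
  note bounds = lasso_error_bounds[OF assms(2,12) T0 P d0 sol' noise h off_image[unfolded L_def u_def]]

  have "norm (\<beta>_init - \<beta>)
      \<le> lam X * \<sigma> * sqrt (real s0) * (sqrt ((const_D0 X s s0 d0)\<^sup>2 + (const_D1 X s s0 d0)\<^sup>2) + 1)"
  proof -
    have "\<beta>_init - \<beta> = h - zero_off (-T0) \<beta>"
      using zero_off_Compl[of T0 \<beta>] by (simp add: h algebra_simps)
    then have "norm (\<beta>_init - \<beta>) \<le> norm h + norm (zero_off (-T0) \<beta>)"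
      by (simp add: norm_triangle_ineq4)
    also have "\<dots> \<le> u * sqrt ((const_D0 X s s0 d0)\<^sup>2 + (const_D1 X s s0 d0)\<^sup>2) + u"
      using bounds(1) off by (simp add: u_def)
    finally show ?thesis by (simp add: u_def P_def distrib_left)
  qed
  moreover have l1: "l1_norm_on h T0 + l1_norm_on h (-T0)
      = l1_norm_on (\<beta> - \<beta>_init) T0 + l1_norm_on \<beta>_init (-T0)"
    by (simp add: l1_norm_on_def h zero_off_def abs_minus_commute)
  moreover have "l1_norm_on (\<beta> - \<beta>_init) T0 + l1_norm_on \<beta>_init (-T0)
      \<le> const_D2 X s s0 d0 * lam X * \<sigma> * real s0"
    using bounds(2) unfolding l1 by (simp add: P_def mult.assoc)
  moreover have "W \<le> const_D3 X s s0 d0 * lam X * \<sigma> * sqrt (real s0)"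
  proof -
    have re: "RE (card T0) 4 X" using assms(12) T0 by simp
    have "W \<le> L * u + 3 / 2 * RE_K X s0 3 * (d0 * P) * sqrt (real s0)"
      using lasso_prediction_error[OF re sol' mult_pos_pos[OF d0 P] noise] off_image
      by (simp add: W_def T0)
    also have "\<dots> = (L + d0 * RE_K X s0 3 / 2 + d0 * RE_K X s0 3) * u"
      by (simp add: u_def algebra_simps)
    also have "\<dots> \<le> const_D3 X s s0 d0 * u"
      using RE_cone_three(2)[OF assms(12)] d0 P
      by (intro mult_right_mono) (auto simp: const_D3_def L_def u_def)
    finally show ?thesis by (simp add: u_def P_def mult.assoc)
  qed
  moreover have "W \<le> norm (X *v \<beta> - submatrix_mult X I0 \<beta>) / sqrt (real CARD('n))
      + 3 / 2 * RE_K X (card I0) 4 * lam_n * sqrt (real (card I0))"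
    if re: "RE (card I0) 4 X" for I0
  proof -
    have eq: "X *v \<beta> - submatrix_mult X I0 \<beta> = X *v zero_off (-I0) \<beta>"
      using arg_cong[OF zero_off_Compl[of I0 \<beta>], of "(*v) X"]
      by (simp add: submatrix_mult_eq matrix_vector_right_distrib algebra_simps)
    have "W \<le> norm (X *v zero_off (-I0) \<beta>) / sqrt (real CARD('n))
        + 3 / 2 * RE_K X (card I0) 3 * (d0 * P) * sqrt (real (card I0))"
      unfolding W_def by (rule lasso_prediction_error[OF re sol' mult_pos_pos[OF d0 P] noise])
    also have "3 / 2 * RE_K X (card I0) 3 * (d0 * P) * sqrt (real (card I0))
        \<le> 3 / 2 * RE_K X (card I0) 4 * (d0 * P) * sqrt (real (card I0))"
      using RE_cone_three(2)[OF re] d0 P by (intro mult_right_mono) auto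
    finally show ?thesis by (simp add: eq lam_n)
  qed
  ultimately show "norm (\<beta>_init - \<beta>)
         \<le> lam X * \<sigma> * sqrt (real s0)
            * (sqrt ((const_D0 X s s0 d0)\<^sup>2 + (const_D1 X s s0 d0)\<^sup>2) + 1)
     \<and> l1_norm_on h T0 + l1_norm_on h (-T0)
         = l1_norm_on (\<beta> - \<beta>_init) T0 + l1_norm_on \<beta>_init (-T0)
     \<and> l1_norm_on (\<beta> - \<beta>_init) T0 + l1_norm_on \<beta>_init (-T0)
         \<le> const_D2 X s s0 d0 * lam X * \<sigma> * real s0
     \<and> norm (X *v \<beta>_init - X *v \<beta>) / sqrt (real CARD('n))
         \<le> const_D3 X s s0 d0 * lam X * \<sigma> * sqrt (real s0)
     \<and> (\<forall>I0. I0 \<subseteq> S \<and> RE (card I0) 4 X \<longrightarrow>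
          norm (X *v \<beta>_init - X *v \<beta>) / sqrt (real CARD('n))
            \<le> norm (X *v \<beta> - submatrix_mult X I0 \<beta>) / sqrt (real CARD('n))
               + 3 / 2 * RE_K X (card I0) 4 * lam_n * sqrt (real (card I0)))"
    unfolding W_def by blast
qed

end
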